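(* Let $D$ be a finite digraph that contains no blocking odd cycle as an induced subdigraph, and suppose that the underlying graph $U(D)$ is series-parallel. Then $D$ is BE-diperfect.
   Context: Digraphs have no loops and no parallel arcs, but may contain both arcs $uv$ and $vu$ (cycles of length two). Two vertices $u,v$ are adjacent if $uv$ or $vu$ is an arc. $U(D)$ is the simple graph on $V(D)$ whose edges are the pairs of vertices adjacent in $D$. A stable set is a set of pairwise non-adjacent vertices; it is maximum if no stable set has larger cardinality. A path of $D$ is a directed path, i.e. a sequence $v_1v_2\cdots v_\ell$ of distinct vertices ($\ell\ge 1$) with $v_iv_{i+1}\in A(D)$ for $1\le i<\ell$. A path partition of $D$ is a collection of paths whose vertex sets partition $V(D)$. For a stable set $S$, an $S_{\rm BE}$-path partition of $D$ is a path partition $\mathcal P$ such that every $P=x_1x_2\cdots x_k\in\mathcal P$ satisfies $V(P)\cap S=\{x\}$ with $x\in\{x_1,x_k\}$. A digraph satisfies the BE-property if it has an $S_{\rm BE}$-path partition for every maximum stable set $S$. A digraph is BE-diperfect if every induced subdigraph of it satisfies the BE-property. A source is a vertex with no in-neighbor, a sink is a vertex with no out-neighbor. A digraph $C$ is a blocking odd cycle if $U(C)$ is a cycle $x_1x_2\cdots x_{2k+1}x_1$ for some integer $k\ge 1$, and each of $x_1$ and $x_2$ is either a source or a sink in $C$. A graph is series-parallel if it can be obtained from the null graph (no vertices) by repeatedly applying the following operations: (i) adding a vertex with degree at most one; (ii) adding a loop; (iii) adding a parallel edge; (iv) subdividing an edge. *)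

theory Defs
  imports "Graph_Theory.Digraph_Component_Vwalk" "HOL-Library.Multiset"
begin

text \<open>
  An undirected multigraph is a pair of a vertex set and a multiset of edges. An edge is the set
  of its ends: parallel edges are repeated elements of the multiset, a loop at \<open>v\<close> is \<open>{v}\<close>.
  Edges carry no names, so that closure of the class below under renaming of edges is built in.
\<close>

type_synonym 'a mgraph = "'a set \<times> 'a set multiset"

text \<open>Adding an edge parallel to a loop, and subdividing a loop, are allowed.\<close>

inductive series_parallel :: "'a mgraph \<Rightarrow> bool" where
  null: "series_parallel ({}, {#})"
| isolated_vertex:
    "\<lbrakk>series_parallel (V, E); w \<notin> V\<rbrakk> \<Longrightarrow> series_parallel (insert w V, E)"
| pendant_vertex:
    "\<lbrakk>series_parallel (V, E); w \<notin> V; v \<in> V\<rbrakk>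
      \<Longrightarrow> series_parallel (insert w V, add_mset {v, w} E)"
| loop:
    "\<lbrakk>series_parallel (V, E); v \<in> V\<rbrakk> \<Longrightarrow> series_parallel (V, add_mset {v} E)"
| parallel:
    "\<lbrakk>series_parallel (V, E); e \<in># E\<rbrakk> \<Longrightarrow> series_parallel (V, add_mset e E)"
| subdivide:
    "\<lbrakk>series_parallel (V, E); {u, v} \<in># E; w \<notin> V\<rbrakk>
      \<Longrightarrow> series_parallel (insert w V, E - {#{u, v}#} + {#{u, w}, {w, v}#})"

text \<open>The cycle \<open>x\<^sub>1 x\<^sub>2 \<dots> x\<^sub>n x\<^sub>1\<close>, for a list of \<open>n \<ge> 3\<close> distinct vertices.\<close>

definition cycle_mgraph :: "'a list \<Rightarrow> 'a mgraph" where
  "cycle_mgraph xs =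
    (set xs, mset (map (\<lambda>i. {xs ! i, xs ! (Suc i mod length xs)}) [0..<length xs]))"

definition adjacent :: "('a, 'b) pre_digraph \<Rightarrow> 'a \<Rightarrow> 'a \<Rightarrow> bool" where
  "adjacent D u v \<longleftrightarrow> u \<rightarrow>\<^bsub>D\<^esub> v \<or> v \<rightarrow>\<^bsub>D\<^esub> u"

text \<open>
  A cycle of length two in \<open>D\<close> gives a single edge here. The edge set is turned into a multiset
  by \<^const>\<open>mset_set\<close>, which is meaningful only for finite sets, hence for finite \<open>D\<close>.
\<close>

definition underlying_graph :: "('a, 'b) pre_digraph \<Rightarrow> 'a mgraph" where
  "underlying_graph D = (verts D, mset_set {{u, v} | u v. adjacent D u v})"

definition stable_set :: "('a, 'b) pre_digraph \<Rightarrow> 'a set \<Rightarrow> bool" where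
  "stable_set D S \<longleftrightarrow> S \<subseteq> verts D \<and> (\<forall>u\<in>S. \<forall>v\<in>S. u \<noteq> v \<longrightarrow> \<not> adjacent D u v)"

definition maximum_stable_set :: "('a, 'b) pre_digraph \<Rightarrow> 'a set \<Rightarrow> bool" where
  "maximum_stable_set D S \<longleftrightarrow>
    stable_set D S \<and> (\<forall>T. stable_set D T \<longrightarrow> card T \<le> card S)"

definition path_partition :: "('a, 'b) pre_digraph \<Rightarrow> 'a vwalk set \<Rightarrow> bool" where
  "path_partition D P \<longleftrightarrow>
    (\<forall>p\<in>P. vpath p D) \<and> (\<Union>p\<in>P. set p) = verts D \<and>
    (\<forall>p\<in>P. \<forall>q\<in>P. p \<noteq> q \<longrightarrow> set p \<inter> set q = {})"

definition BE_path_partition :: "('a, 'b) pre_digraph \<Rightarrow> 'a set \<Rightarrow> 'a vwalk set \<Rightarrow> bool" where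
  "BE_path_partition D S P \<longleftrightarrow>
    path_partition D P \<and> (\<forall>p\<in>P. \<exists>x. set p \<inter> S = {x} \<and> x \<in> {hd p, last p})"

definition BE_property :: "('a, 'b) pre_digraph \<Rightarrow> bool" where
  "BE_property D \<longleftrightarrow> (\<forall>S. maximum_stable_set D S \<longrightarrow> (\<exists>P. BE_path_partition D S P))"

definition BE_diperfect :: "('a, 'b) pre_digraph \<Rightarrow> bool" where
  "BE_diperfect D \<longleftrightarrow> (\<forall>H. induced_subgraph H D \<longrightarrow> BE_property H)"

definition source :: "('a, 'b) pre_digraph \<Rightarrow> 'a \<Rightarrow> bool" where
  "source D v \<longleftrightarrow> v \<in> verts D \<and> (\<nexists>u. u \<rightarrow>\<^bsub>D\<^esub> v)"

definition sink :: "('a, 'b) pre_digraph \<Rightarrow> 'a \<Rightarrow> bool" where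
  "sink D v \<longleftrightarrow> v \<in> verts D \<and> (\<nexists>u. v \<rightarrow>\<^bsub>D\<^esub> u)"

text \<open>Lists are indexed from 0: the vertices \<open>x\<^sub>1\<close> and \<open>x\<^sub>2\<close> are \<open>xs ! 0\<close> and \<open>xs ! 1\<close>.\<close>

definition blocking_odd_cycle :: "('a, 'b) pre_digraph \<Rightarrow> bool" where
  "blocking_odd_cycle C \<longleftrightarrow> digraph C \<and>
    (\<exists>k xs. k \<ge> 1 \<and> length xs = 2 * k + 1 \<and> distinct xs \<and>
      underlying_graph C = cycle_mgraph xs \<and>
      (source C (xs ! 0) \<or> sink C (xs ! 0)) \<and>
      (source C (xs ! 1) \<or> sink C (xs ! 1)))"

end

theory Submission
  imports Defs
begin

text \<open>
  Fix a maximum stable set \<open>S\<close>. The proof is by induction on the number of vertices. If a set \<open>X\<close> of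
  vertices has a partition into paths of the required kind, and no stable set outside \<open>X\<close> is larger
  than \<open>S - X\<close>, then \<open>X\<close> can be removed. It therefore suffices to find such an \<open>X\<close>, or another
  reduction, near vertices of degree at most two.

  Series-parallel graphs are partial 2-trees (\<open>series_parallel_partial_2_tree\<close>), a class closed under
  contraction whose nonempty members have a vertex of degree at most two. Applying this to the graph
  obtained by contracting all vertices of degree two shows that every nonempty partial 2-tree
  contains one of six configurations (\<open>partial_2_tree_configuration\<close>): a simplicial vertex of degree at
  most two, two vertices of degree two with the same neighbours, or a chain \<open>w v u z\<close> with \<open>v\<close> and \<open>u\<close> of
  degree two that is part of a longer chain, has adjacent ends, or has its ends joined by a second
  chain with one or two inner vertices.

  Chains are reduced according to how \<open>S\<close> meets them. If \<open>S\<close> avoids \<open>v\<close> and \<open>u\<close>, then \<open>w\<close> and \<open>z\<close> are in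
  \<open>S\<close>. Either the edges \<open>wv\<close> and \<open>zu\<close> can be removed, or an exchange argument yields an alternating path
  of even length between \<open>w\<close> and \<open>z\<close>. It closes up to an odd induced cycle through \<open>v\<close> and \<open>u\<close>, which is
  not blocking, so that one of the paths \<open>w v u\<close> and \<open>z u v\<close> is directed and can be removed
  (\<open>uncovered_link_step\<close>). If \<open>v\<close> and \<open>z\<close> are in \<open>S\<close>, the chain is contracted to one edge oriented like
  \<open>wv\<close> (\<open>contract_step\<close>). If \<open>v\<close> is in \<open>S\<close> but \<open>z\<close> is not, the rest of the configuration is needed.

  The contraction may create blocking odd cycles, but only with a special vertex in \<open>S\<close>. For this
  reason the induction uses a hypothesis relative to \<open>S\<close> (\<open>be_instance\<close>): no odd induced cycle has two
  adjacent vertices outside \<open>S\<close> each of which is a source or a sink of it.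
\<close>

section \<open>Partial k-trees\<close>

text \<open>
  Partial 2-trees take the place of series-parallel graphs because closure under subgraphs and
  contractions is easy to prove for them by induction on the construction. The new vertex may be
  joined to a clique of any size up to \<open>k\<close>; this is what makes the class closed
  under deleting vertices, with no exception for small graphs.
\<close>

inductive k_tree :: "nat \<Rightarrow> 'a set \<Rightarrow> ('a \<times> 'a) set \<Rightarrow> bool" for k where
  empty: "k_tree k {} {}"
| add: "\<lbrakk>k_tree k V E; w \<notin> V; K \<subseteq> V; finite K; card K \<le> k; \<And>x y. \<lbrakk>x \<in> K; y \<in> K; x \<noteq> y\<rbrakk> \<Longrightarrow> (x, y) \<in> E\<rbrakk>
    \<Longrightarrow> k_tree k (insert w V) (E \<union> {w} \<times> K \<union> K \<times> {w})"

definition partial_k_tree :: "nat \<Rightarrow> 'a set \<Rightarrow> ('a \<Rightarrow> 'a \<Rightarrow> bool) \<Rightarrow> bool" where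
  "partial_k_tree k V R \<longleftrightarrow> (\<exists>E. k_tree k V E \<and> (\<forall>s\<in>V. \<forall>t\<in>V. s \<noteq> t \<longrightarrow> R s t \<longrightarrow> (s, t) \<in> E))"

lemma k_tree_edges:
  assumes "k_tree k V E"
  shows "E \<subseteq> V \<times> V" "sym E" "(x, y) \<in> E \<Longrightarrow> x \<noteq> y"
  using assms by (induction, auto simp: sym_def)

lemma k_tree_finite: "k_tree k V E \<Longrightarrow> finite V"
  by (induction rule: k_tree.induct) auto

lemma k_tree_restrict:
  assumes "k_tree k V E"
  shows "k_tree k (V \<inter> U) (E \<inter> U \<times> U)"
  using assms
proof induction
  case empty
  then show ?case by (simp add: k_tree.empty)
next
  case (add V E w K)
  show ?case
  proof (cases "w \<in> U")
    case True
    have "k_tree k (insert w (V \<inter> U)) (E \<inter> U \<times> U \<union> {w} \<times> (K \<inter> U) \<union> (K \<inter> U) \<times> {w})"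
      using add by (intro k_tree.add) (auto intro: card_mono[THEN order_trans])
    moreover have "insert w V \<inter> U = insert w (V \<inter> U)" using True by auto
    moreover have "(E \<union> {w} \<times> K \<union> K \<times> {w}) \<inter> U \<times> U = E \<inter> U \<times> U \<union> {w} \<times> (K \<inter> U) \<union> (K \<inter> U) \<times> {w}"
      using True by auto
    ultimately show ?thesis by simp
  next
    case False
    then have "insert w V \<inter> U = V \<inter> U" "(E \<union> {w} \<times> K \<union> K \<times> {w}) \<inter> U \<times> U = E \<inter> U \<times> U"
      by auto
    then show ?thesis using add.IH by simp
  qed
qed

lemma k_tree_rename:
  assumes "k_tree k V E" "inj_on f V"
  shows "k_tree k (f ` V) (map_prod f f ` E)"
  using assms
proof induction
  case empty
  then show ?case by (simp add: k_tree.empty)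
next
  case (add V E w K)
  have "k_tree k (insert (f w) (f ` V)) (map_prod f f ` E \<union> {f w} \<times> f ` K \<union> f ` K \<times> {f w})"
  proof (rule k_tree.add)
    show "k_tree k (f ` V) (map_prod f f ` E)" using add by simp
    show "f w \<notin> f ` V" using add by auto
    show "f ` K \<subseteq> f ` V" "finite (f ` K)" using add by auto
    show "card (f ` K) \<le> k" using add by (meson card_image_le order_trans)
    show "(x, y) \<in> map_prod f f ` E" if "x \<in> f ` K" "y \<in> f ` K" "x \<noteq> y" for x y
      using that add.hyps by force
  qed
  moreover have "map_prod f f ` (E \<union> {w} \<times> K \<union> K \<times> {w}) =
      map_prod f f ` E \<union> {f w} \<times> f ` K \<union> f ` K \<times> {f w}"
    by (auto simp: image_iff) 
  ultimately show ?case by simp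
qed

text \<open>
  If the last vertex \<open>w\<close> is joined to the clique \<open>K\<close> and \<open>w\<close> is contracted into a vertex of \<open>K\<close>,
  nothing new appears, because \<open>K\<close> is a clique. If \<open>x \<in> K\<close> is contracted into \<open>w\<close>, the result is the
  previous tree with \<open>x\<close> renamed to \<open>w\<close>. Otherwise the contraction takes place in the previous tree
  and maps \<open>K\<close> to a clique.
\<close>

lemma k_tree_contract:
  assumes "k_tree k V E" "(x, a) \<in> E"
  shows "\<exists>E'. k_tree k (V - {x}) E' \<and>
    (\<forall>s t. (s, t) \<in> E \<longrightarrow> (id(x := a)) s \<noteq> (id(x := a)) t \<longrightarrow> ((id(x := a)) s, (id(x := a)) t) \<in> E')"
  using assms
proof induction
  case empty
  then show ?case by simp
next
  case (add V E w K)
  note EV = k_tree_edges[OF add.hyps(1)]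
  have symE: "(t, s) \<in> E" if "(s, t) \<in> E" for s t using EV(2) that by (auto simp: sym_def)
  consider (new) "x = w" "a \<in> K" | (onto) "a = w" "x \<in> K" | (old) "(x, a) \<in> E"
    using add.prems by auto
  then show ?case
  proof cases
    case new
    then have "insert w V - {x} = V" "a \<noteq> w" using add by auto
    moreover have "(s, w) \<notin> E" "(w, s) \<notin> E" for s using EV(1) add.hyps(2) by auto
    moreover have "w \<notin> K" using add.hyps by auto
    ultimately show ?thesis using add.hyps new
      by (intro exI[of _ E]) (auto simp: fun_upd_apply)
  next
    case onto
    let ?f = "id(x := w)"
    have inj: "inj_on ?f V" using add.hyps(2) by (auto simp: inj_on_def)
    have im: "?f ` V = insert w V - {x}" using onto add.hyps by auto
    have "(?f s, ?f t) \<in> map_prod ?f ?f ` E" if "(s, t) \<in> E" for s t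
      using that by force
    moreover have "(w, t) \<in> map_prod ?f ?f ` E" if "t \<in> K" "t \<noteq> x" for t
    proof -
      have "(x, t) \<in> E" using that onto add.hyps by auto
      then have "map_prod ?f ?f (x, t) \<in> map_prod ?f ?f ` E" by (rule imageI)
      then show ?thesis using that by simp
    qed
    moreover have "(t, w) \<in> map_prod ?f ?f ` E" if "t \<in> K" "t \<noteq> x" for t
    proof -
      have "(t, x) \<in> E" using that onto add.hyps by auto
      then have "map_prod ?f ?f (t, x) \<in> map_prod ?f ?f ` E" by (rule imageI)
      then show ?thesis using that by simp
    qed
    ultimately obtain E0 where E0: "k_tree k (insert w V - {x}) E0" "\<And>s t. (s, t) \<in> E \<Longrightarrow> (?f s, ?f t) \<in> E0"
        "\<And>t. t \<in> K \<Longrightarrow> t \<noteq> x \<Longrightarrow> (w, t) \<in> E0 \<and> (t, w) \<in> E0"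
      using k_tree_rename[OF add.hyps(1) inj] unfolding im by blast
    have "(?f s, ?f t) \<in> E0" if st: "(s, t) \<in> E \<union> {w} \<times> K \<union> K \<times> {w}" "?f s \<noteq> ?f t" for s t
    proof (cases "(s, t) \<in> E")
      case False
      then have "s = w \<and> t \<in> K \<or> t = w \<and> s \<in> K" using st(1) by auto
      then show ?thesis using E0(3) st(2) by (auto split: if_splits)
    qed (rule E0(2))
    then show ?thesis using E0(1) onto(1) by blast
  next
    case old
    let ?f = "id(x := a)"
    from add.IH[OF old] obtain E' where E': "k_tree k (V - {x}) E'"
      and E'e: "\<And>s t. (s, t) \<in> E \<Longrightarrow> ?f s \<noteq> ?f t \<Longrightarrow> (?f s, ?f t) \<in> E'" by blast
    have ax: "a \<noteq> x" "a \<in> V" "x \<in> V" "x \<noteq> w" "a \<noteq> w" using EV old add.hyps(2) by auto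
    have "k_tree k (insert w (V - {x})) (E' \<union> {w} \<times> ?f ` K \<union> ?f ` K \<times> {w})"
    proof (rule k_tree.add)
      show "?f ` K \<subseteq> V - {x}" using add.hyps ax by auto
      show "card (?f ` K) \<le> k" using add.hyps by (meson card_image_le order_trans)
      show "(s, t) \<in> E'" if st: "s \<in> ?f ` K" "t \<in> ?f ` K" "s \<noteq> t" for s t
      proof -
        from st obtain s' t' where "s = ?f s'" "t = ?f t'" "s' \<in> K" "t' \<in> K" by blast
        then show ?thesis using st(3) E'e[of s' t'] add.hyps(6)[of s' t'] by metis
      qed
    qed (use E' add.hyps in auto)
    moreover have "insert w (V - {x}) = insert w V - {x}" using ax by auto
    moreover have "(?f s, ?f t) \<in> E' \<union> {w} \<times> ?f ` K \<union> ?f ` K \<times> {w}"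
      if "(s, t) \<in> E \<union> {w} \<times> K \<union> K \<times> {w}" "?f s \<noteq> ?f t" for s t
    proof -
      have "?f w = w" using ax by simp
      then show ?thesis using that E'e by (metis (no_types, lifting) SigmaE Un_iff image_eqI mem_Sigma_iff singletonD singletonI)
    qed
    ultimately show ?thesis by metis
  qed
qed

lemma partial_k_tree_subgraph:
  assumes "partial_k_tree k V R" "U \<subseteq> V" "\<And>s t. \<lbrakk>s \<in> U; t \<in> U; s \<noteq> t; R' s t\<rbrakk> \<Longrightarrow> R s t"
  shows "partial_k_tree k U R'"
proof -
  from assms(1) obtain E where "k_tree k V E" "\<forall>s\<in>V. \<forall>t\<in>V. s \<noteq> t \<longrightarrow> R s t \<longrightarrow> (s, t) \<in> E"
    unfolding partial_k_tree_def by blast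
  then have "k_tree k U (E \<inter> U \<times> U)" "\<forall>s\<in>U. \<forall>t\<in>U. s \<noteq> t \<longrightarrow> R' s t \<longrightarrow> (s, t) \<in> E \<inter> U \<times> U"
    using k_tree_restrict[of k V E U] assms(2,3) by (simp add: inf.absorb2, blast)
  then show ?thesis unfolding partial_k_tree_def by blast
qed

text \<open>
  Simultaneous contraction: every vertex of \<open>X\<close> is contracted into a neighbour outside \<open>X\<close>, so that no
  chain of contractions arises and the order does not matter.
\<close>

lemma k_tree_contract_set:
  assumes "finite X" "k_tree k V E" "\<And>x. x \<in> X \<Longrightarrow> f x \<notin> X \<and> (x, f x) \<in> E"
  shows "\<exists>E'. k_tree k (V - X) E' \<and>
    (\<forall>s t. (s, t) \<in> E \<longrightarrow> override_on id f X s \<noteq> override_on id f X t \<longrightarrow>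
      (override_on id f X s, override_on id f X t) \<in> E')"
  using assms(1,3)
proof (induction X rule: finite_induct)
  case empty
  then show ?case using assms(2) by auto
next
  case (insert x X)
  let ?c = "override_on id f X" and ?d = "override_on id f (insert x X)" and ?m = "id(x := f x)"
  have prem: "\<And>y. y \<in> X \<Longrightarrow> f y \<notin> X \<and> (y, f y) \<in> E" using insert.prems by simp
  obtain E' where E': "k_tree k (V - X) E'"
    and E'e: "\<And>s t. (s, t) \<in> E \<Longrightarrow> ?c s \<noteq> ?c t \<Longrightarrow> (?c s, ?c t) \<in> E'"
    using insert.IH[OF prem] by blast
  have fx: "f x \<noteq> x" "f x \<notin> X" "(x, f x) \<in> E" using insert.prems[of x] by auto
  have "?c x = x" "?c (f x) = f x" using fx insert.hyps by simp_all
  then have "(x, f x) \<in> E'" using E'e[OF fx(3)] fx(1) by simp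
  from k_tree_contract[OF E' this] obtain E'' where E'': "k_tree k (V - X - {x}) E''"
    and E''e: "\<And>s t. (s, t) \<in> E' \<Longrightarrow> ?m s \<noteq> ?m t \<Longrightarrow> (?m s, ?m t) \<in> E''"
    by blast
  have d: "?d s = ?m (?c s)" for s
  proof (cases "s \<in> X")
    case True
    then have "f s \<noteq> x" using insert.prems[of s] by auto
    then show ?thesis using True by simp
  next
    case False
    then show ?thesis by (cases "s = x") simp_all
  qed
  have "(?d s, ?d t) \<in> E''" if st: "(s, t) \<in> E" "?d s \<noteq> ?d t" for s t
  proof -
    have "?c s \<noteq> ?c t" using st(2) unfolding d by metis
    then show ?thesis using E''e[OF E'e[OF st(1)]] st(2) unfolding d by blast
  qed
  moreover have "V - X - {x} = V - insert x X" by auto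
  ultimately show ?case using E'' by metis
qed

lemma partial_k_tree_contract:
  assumes R: "partial_k_tree k V R" and X: "X \<subseteq> V" "\<And>x. x \<in> X \<Longrightarrow> f x \<in> V - X \<and> R x (f x)"
    and R': "\<And>p q. \<lbrakk>p \<in> V - X; q \<in> V - X; p \<noteq> q; R' p q\<rbrakk> \<Longrightarrow>
      \<exists>s\<in>V. \<exists>t\<in>V. R s t \<and> override_on id f X s = p \<and> override_on id f X t = q"
  shows "partial_k_tree k (V - X) R'"
proof -
  from R obtain E where E: "k_tree k V E"
    and Ee: "\<And>s t. s \<in> V \<Longrightarrow> t \<in> V \<Longrightarrow> s \<noteq> t \<Longrightarrow> R s t \<Longrightarrow> (s, t) \<in> E"
    unfolding partial_k_tree_def by blast
  have "finite X" using X(1) k_tree_finite[OF E] finite_subset by blast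
  moreover have "f x \<notin> X \<and> (x, f x) \<in> E" if "x \<in> X" for x
    using X(1) X(2)[OF that] Ee[of x "f x"] that by (metis DiffD1 DiffD2 subsetD)
  ultimately obtain E' where E': "k_tree k (V - X) E'"
    and E'e: "\<And>s t. (s, t) \<in> E \<Longrightarrow> override_on id f X s \<noteq> override_on id f X t \<Longrightarrow>
      (override_on id f X s, override_on id f X t) \<in> E'"
    using k_tree_contract_set[OF _ E, of X f] by blast
  have "(p, q) \<in> E'" if pq: "p \<in> V - X" "q \<in> V - X" "p \<noteq> q" "R' p q" for p q
  proof -
    obtain s t where st: "s \<in> V" "t \<in> V" "R s t" "override_on id f X s = p" "override_on id f X t = q"
      using R'[OF pq] by blast
    then show ?thesis using E'e[OF Ee[of s t]] pq(3) by auto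
  qed
  then show ?thesis unfolding partial_k_tree_def using E' by blast
qed

text \<open>
  The vertex added last is a witness.
\<close>

lemma partial_k_tree_degenerate:
  assumes "partial_k_tree k V R" "V \<noteq> {}"
  shows "\<exists>x\<in>V. card {y \<in> V. y \<noteq> x \<and> R x y} \<le> k"
proof -
  from assms(1) obtain E where E: "k_tree k V E" "\<And>s t. s \<in> V \<Longrightarrow> t \<in> V \<Longrightarrow> s \<noteq> t \<Longrightarrow> R s t \<Longrightarrow> (s, t) \<in> E"
    unfolding partial_k_tree_def by blast
  from E(1) show ?thesis
  proof cases
    case empty
    then show ?thesis using assms(2) by simp
  next
    case (add V' E' w K)
    have "{y \<in> V. y \<noteq> w \<and> R w y} \<subseteq> K"
      using E(2)[of w] k_tree_edges(1)[OF add(3)] add by fastforce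
    then have "card {y \<in> V. y \<noteq> w \<and> R w y} \<le> k" using add by (meson card_mono order_trans)
    then show ?thesis using add by blast
  qed
qed

text \<open>
  Subdividing an edge \<open>uv\<close> by \<open>w\<close> keeps \<open>uv\<close> in the 2-tree and joins \<open>w\<close> to that clique; loops and
  parallel edges are ignored.
\<close>

lemma series_parallel_partial_2_tree:
  assumes "series_parallel G"
  shows "partial_k_tree 2 (fst G) (\<lambda>s t. {s, t} \<in># snd G)"
proof -
  have "(\<forall>e\<in>#snd G. e \<subseteq> fst G) \<and> (\<exists>E. k_tree 2 (fst G) E \<and> (\<forall>s t. {s, t} \<in># snd G \<longrightarrow> s \<noteq> t \<longrightarrow> (s, t) \<in> E))"
    using assms
  proof induction
    case null
    then show ?case by (auto intro: k_tree.empty)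
  next
    case (isolated_vertex V E w)
    then obtain F where F: "k_tree 2 V F" "\<And>s t. {s, t} \<in># E \<Longrightarrow> s \<noteq> t \<Longrightarrow> (s, t) \<in> F" by auto
    have "k_tree 2 (insert w V) (F \<union> {w} \<times> {} \<union> {} \<times> {w})"
      using F(1) isolated_vertex by (intro k_tree.add) auto
    then show ?case using F isolated_vertex by auto
  next
    case (pendant_vertex V E w v)
    then obtain F where F: "k_tree 2 V F" "\<And>s t. {s, t} \<in># E \<Longrightarrow> s \<noteq> t \<Longrightarrow> (s, t) \<in> F" by auto
    have "k_tree 2 (insert w V) (F \<union> {w} \<times> {v} \<union> {v} \<times> {w})"
      using F(1) pendant_vertex by (intro k_tree.add) auto
    moreover have "(s, t) \<in> F \<union> {w} \<times> {v} \<union> {v} \<times> {w}" if "{s, t} \<in># add_mset {v, w} E" "s \<noteq> t" for s t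
      using that F(2)[of s t] by (auto simp: doubleton_eq_iff)
    moreover have "\<forall>e\<in>#add_mset {v, w} E. e \<subseteq> insert w V" using pendant_vertex by auto
    ultimately show ?case by (metis fst_conv snd_conv)
  next
    case (loop V E v)
    then show ?case by (auto simp: doubleton_eq_iff)
  next
    case (parallel V E e)
    then show ?case by auto
  next
    case (subdivide V E u v w)
    then obtain F where F: "k_tree 2 V F" "\<And>s t. {s, t} \<in># E \<Longrightarrow> s \<noteq> t \<Longrightarrow> (s, t) \<in> F" by auto
    have uv: "u \<in> V" "v \<in> V" using subdivide by fastforce+
    have "k_tree 2 (insert w V) (F \<union> {w} \<times> {u, v} \<union> {u, v} \<times> {w})"
    proof (rule k_tree.add[OF F(1)])
      show "card {u, v} \<le> 2" by (simp add: card_insert_if)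
      show "(x, y) \<in> F" if "x \<in> {u, v}" "y \<in> {u, v}" "x \<noteq> y" for x y
      proof -
        have "{x, y} = {u, v}" using that by auto
        then show ?thesis using F(2) subdivide(2) that(3) by simp
      qed
    qed (use uv subdivide in auto)
    moreover have "(s, t) \<in> F \<union> {w} \<times> {u, v} \<union> {u, v} \<times> {w}"
      if "{s, t} \<in># E - {#{u, v}#} + {#{u, w}, {w, v}#}" "s \<noteq> t" for s t
      using that F(2)[of s t] by (auto simp: doubleton_eq_iff dest: in_diffD)
    moreover have "\<forall>e\<in>#E - {#{u, v}#} + {#{u, w}, {w, v}#}. e \<subseteq> insert w V"
      using uv subdivide by (auto dest!: in_diffD)
    ultimately show ?case by (metis fst_conv snd_conv)
  qed
  then show ?thesis unfolding partial_k_tree_def by blast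
qed

section \<open>Unavoidable configurations in partial 2-trees\<close>

definition nbrs :: "('a \<Rightarrow> 'a \<Rightarrow> bool) \<Rightarrow> 'a set \<Rightarrow> 'a \<Rightarrow> 'a set" where
  "nbrs R V x = {y \<in> V. R x y}"

text \<open>
  A chain \<open>w v u z\<close> whose two inner vertices have degree two.
\<close>

definition link :: "('a \<Rightarrow> 'a \<Rightarrow> bool) \<Rightarrow> 'a set \<Rightarrow> 'a \<Rightarrow> 'a \<Rightarrow> 'a \<Rightarrow> 'a \<Rightarrow> bool" where
  "link R V w v u z \<longleftrightarrow> v \<in> V \<and> u \<in> V \<and> nbrs R V v = {u, w} \<and> nbrs R V u = {v, z} \<and>
    w \<noteq> z \<and> w \<noteq> u \<and> z \<noteq> v"

lemma link_sym: "link R V w v u z \<longleftrightarrow> link R V z u v w"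
  unfolding link_def by auto

text \<open>
  Let \<open>W\<close> be the set of vertices of degree at least three and contract every other vertex into a
  neighbour in \<open>W\<close>; without simplicial vertices and long chains such a neighbour exists. The result \<open>H\<close> joins the ends of every chain. In the absence of
  the other configurations two chains that leave \<open>p \<in> W\<close> never have the same far end, so \<open>p\<close> keeps
  its degree in \<open>H\<close>. Thus \<open>H\<close> is a partial 2-tree of minimum degree at least three, which is absurd.
\<close>

lemma partial_2_tree_configuration:
  assumes pt: "partial_k_tree 2 V R" and ne: "V \<noteq> {}"
    and sym: "\<And>x y. R x y \<longleftrightarrow> R y x" and irrefl: "\<And>x. \<not> R x x"
  obtains
    (simplicial) x where "x \<in> V" "card (nbrs R V x) \<le> 2"
      "\<And>a b. \<lbrakk>a \<in> nbrs R V x; b \<in> nbrs R V x; a \<noteq> b\<rbrakk> \<Longrightarrow> R a b"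
  | (twins) x y a b where "x \<in> V" "y \<in> V" "x \<noteq> y" "a \<noteq> b" "nbrs R V x = {a, b}" "nbrs R V y = {a, b}"
  | (long_chain) a t1 t2 t3 b where "link R V a t1 t2 t3" "link R V t1 t2 t3 b"
  | (chord) w v u z where "link R V w v u z" "R w z"
  | (two_links) w v u z v' u' where "link R V w v u z" "link R V w v' u' z" "v \<noteq> v'"
  | (short_link) w v u z x where "link R V w v u z" "x \<in> V" "nbrs R V x = {w, z}"
proof -
  let ?N = "nbrs R V"
  have fin: "finite V"
    using pt k_tree_finite unfolding partial_k_tree_def by blast
  then have finN: "finite (?N x)" for x unfolding nbrs_def by simp
  have contra: False
    if no: "\<And>x. x \<in> V \<Longrightarrow> card (?N x) \<le> 2 \<Longrightarrow> \<exists>a\<in>?N x. \<exists>b\<in>?N x. a \<noteq> b \<and> \<not> R a b"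
      "\<And>x y a b. x \<in> V \<Longrightarrow> y \<in> V \<Longrightarrow> x \<noteq> y \<Longrightarrow> a \<noteq> b \<Longrightarrow> ?N x = {a, b} \<Longrightarrow> ?N y = {a, b} \<Longrightarrow> False"
      "\<And>a t1 t2 t3 b. link R V a t1 t2 t3 \<Longrightarrow> link R V t1 t2 t3 b \<Longrightarrow> False"
      "\<And>w v u z. link R V w v u z \<Longrightarrow> R w z \<Longrightarrow> False"
      "\<And>w v u z v' u'. link R V w v u z \<Longrightarrow> link R V w v' u' z \<Longrightarrow> v \<noteq> v' \<Longrightarrow> False"
      "\<And>w v u z x. link R V w v u z \<Longrightarrow> x \<in> V \<Longrightarrow> ?N x = {w, z} \<Longrightarrow> False"
  proof -
    define W where "W = {x \<in> V. 2 < card (?N x)}"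
    define X where "X = V - W"
    have VX: "V - X = W" and XV: "X \<subseteq> V" unfolding X_def W_def by auto
    have deg2: "\<exists>b. ?N x = {p, b} \<and> b \<noteq> p \<and> b \<in> V \<and> \<not> R p b" if "x \<in> X" "R x p" "p \<in> V" for x p
    proof -
      have x: "x \<in> V" "card (?N x) \<le> 2" using that(1) unfolding X_def W_def by auto
      then obtain a b where ab: "a \<in> ?N x" "b \<in> ?N x" "a \<noteq> b" "\<not> R a b" using no(1) by blast
      have "{a, b} = ?N x"
        using ab x(2) finN[of x] by (intro card_seteq) auto
      moreover have "p \<in> ?N x" using that unfolding nbrs_def by simp
      ultimately have "?N x = {p, if p = a then b else a}" by auto
      moreover have "\<not> R b a" using ab(4) sym by blast
      ultimately show ?thesis using ab unfolding nbrs_def by (intro exI[of _ "if p = a then b else a"]) auto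
    qed
    have NR: "y \<in> ?N x \<longleftrightarrow> y \<in> V \<and> R x y" for x y unfolding nbrs_def by simp
    have toW: "\<exists>y. y \<in> ?N x \<and> y \<in> W" if x: "x \<in> X" for x
    proof (rule ccontr)
      assume nW: "\<not> ?thesis"
      have "x \<in> V" "card (?N x) \<le> 2" using x unfolding X_def W_def by auto
      then obtain a where a: "a \<in> V" "R x a" using no(1)[of x] NR by blast
      then obtain b where b: "?N x = {a, b}" "b \<noteq> a" "b \<in> V" "\<not> R a b" using deg2[OF x] by blast
      have "R x b" "R a x" "R b x" using b(1) NR[of b x] sym a by auto
      have "a \<in> X" "b \<in> X" using nW a b NR unfolding X_def by auto
      obtain a' where a': "?N a = {x, a'}" "a' \<noteq> x" "\<not> R x a'"
        using deg2[OF \<open>a \<in> X\<close> \<open>R a x\<close> \<open>x \<in> V\<close>] by blast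
      obtain b' where b': "?N b = {x, b'}" "b' \<noteq> x" "\<not> R x b'"
        using deg2[OF \<open>b \<in> X\<close> \<open>R b x\<close> \<open>x \<in> V\<close>] by blast
      have "a' \<noteq> b" "b' \<noteq> a" using a' b' \<open>R x b\<close> a(2) by auto
      have "link R V a' a x b"
        unfolding link_def using a a' b \<open>x \<in> V\<close> \<open>a' \<noteq> b\<close> by auto
      moreover have "link R V a x b b'"
        unfolding link_def using a b' b \<open>x \<in> V\<close> \<open>b' \<noteq> a\<close> by auto
      ultimately show False by (rule no(3))
    qed
    define f where "f x = (SOME y. y \<in> ?N x \<and> y \<in> W)" for x
    have f: "f x \<in> ?N x" "f x \<in> W" if "x \<in> X" for x
      using someI_ex[OF toW[OF that]] unfolding f_def by auto
    define H where "H p q \<longleftrightarrow> (\<exists>s\<in>V. \<exists>t\<in>V. R s t \<and> override_on id f X s = p \<and> override_on id f X t = q)" for p q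
    have HI: "H p q" if "s \<in> V" "t \<in> V" "R s t" "override_on id f X s = p" "override_on id f X t = q" for s t p q
      unfolding H_def using that by blast
    have "partial_k_tree 2 (V - X) H"
    proof (rule partial_k_tree_contract[OF pt XV])
      show "f x \<in> V - X \<and> R x (f x)" if "x \<in> X" for x using f[OF that] NR VX by auto
    qed (simp add: H_def)
    then have ptW: "partial_k_tree 2 W H" unfolding VX .
    have "W \<noteq> {}"
    proof -
      obtain x where "x \<in> V" using ne by blast
      then show ?thesis using toW[of x] unfolding X_def by blast
    qed
    then obtain p where p: "p \<in> W" "card {y \<in> W. y \<noteq> p \<and> H p y} \<le> 2"
      using partial_k_tree_degenerate[OF ptW] by blast
    have pV: "p \<in> V" and pX: "p \<notin> X" using p(1) unfolding X_def W_def by auto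
    \<comment> \<open>\<open>Q n q\<close>: the chain that leaves \<open>p\<close> through its neighbour \<open>n\<close> ends in \<open>q\<close>\<close>
    define Q where "Q n q \<longleftrightarrow> q = n \<or> n \<in> V \<and> ?N n = {p, q} \<or> (\<exists>u. link R V p n u q)" for n q
    have ex: "\<exists>q. q \<in> W \<and> q \<noteq> p \<and> H p q \<and> Q n q" if n: "n \<in> ?N p" for n
    proof (cases "n \<in> W")
      case True
      have "H p n" using n NR pX True pV by (intro HI[of p n]) (auto simp: override_on_def X_def)
      then show ?thesis using True n NR irrefl unfolding Q_def by blast
    next
      case False
      then have nX: "n \<in> X" and nV: "n \<in> V" and "R p n" "R n p" using n NR sym unfolding X_def by auto
      then obtain b where b: "?N n = {p, b}" "b \<noteq> p" "b \<in> V" "\<not> R p b" using deg2[OF nX _ pV] by blast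
      have "R n b" "R b n" using b(1) NR[of b n] sym by auto
      show ?thesis
      proof (cases "b \<in> W")
        case True
        then have bX: "b \<notin> X" unfolding X_def by auto
        have "f n = p \<or> f n = b" using f(1)[OF nX] b(1) by auto
        then have "H p b"
        proof
          assume "f n = p"
          then show ?thesis using nX bX nV b(3) \<open>R n b\<close> by (intro HI[of n b]) simp_all
        next
          assume "f n = b"
          then show ?thesis using nX pX nV pV \<open>R p n\<close> by (intro HI[of p n]) simp_all
        qed
        then show ?thesis using True b nV unfolding Q_def by blast
      next
        case False
        then have bX: "b \<in> X" using b(3) unfolding X_def by auto
        obtain z where z: "?N b = {n, z}" "z \<noteq> n" "\<not> R n z" using deg2[OF bX \<open>R b n\<close> nV] by blast
        have "f b = z" using f[OF bX] z(1) nX unfolding X_def by auto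
        moreover have "f n = p" using f[OF nX] b(1) False by auto
        ultimately have "H p z" using nX bX nV b(3) \<open>R n b\<close> by (intro HI[of n b]) simp_all
        moreover have "z \<noteq> p" using z \<open>R n p\<close> by auto
        moreover have "link R V p n b z"
          unfolding link_def using nV b z \<open>z \<noteq> p\<close> by auto
        ultimately show ?thesis using f(2)[OF bX] \<open>f b = z\<close> unfolding Q_def by blast
      qed
    qed
    have eq_link: False if pq: "R p q" "n \<in> V" "?N n = {p, q}" for n q
    proof -
      have "card (?N n) \<le> 2" unfolding pq(3) by (simp add: card_insert_if)
      then obtain a b where "a \<in> {p, q}" "b \<in> {p, q}" "a \<noteq> b" "\<not> R a b" using no(1)[OF pq(2)] pq(3) by auto
      then show False using pq(1) sym irrefl by blast
    qed
    have inj: "n = n'" if n: "n \<in> ?N p" "Q n q" and n': "n' \<in> ?N p" "Q n' q" and q: "q \<noteq> p" for n n' q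
    proof (rule ccontr)
      assume neq: "n \<noteq> n'"
      have *: False if "q = n" "R p n" "Q n' q" "n \<noteq> n'" for n n'
        using that eq_link[of q n'] no(4)[of p n' _ q] unfolding Q_def by blast
      have **: False if "?N n = {p, q}" "n \<in> V" "Q n' q" "q \<noteq> n'" "n \<noteq> n'" for n n'
        using that no(2)[of n n' p q] no(6)[of p n' _ q n] q unfolding Q_def by blast
      have "R p n" "R p n'" using n n' NR by auto
      moreover have False if "link R V p n u q" "link R V p n' u' q" for u u'
        using no(5)[OF that neq] .
      ultimately show False using *[of n n'] *[of n' n] **[of n n'] **[of n' n] n(2) n'(2) neq
        unfolding Q_def by blast
    qed
    define h where "h n = (SOME q. q \<in> W \<and> q \<noteq> p \<and> H p q \<and> Q n q)" for n
    have h: "h n \<in> W \<and> h n \<noteq> p \<and> H p (h n) \<and> Q n (h n)" if "n \<in> ?N p" for n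
      using someI_ex[OF ex[OF that]] unfolding h_def .
    have "inj_on h (?N p)" using inj h by (intro inj_onI) metis
    moreover have "h ` ?N p \<subseteq> {y \<in> W. y \<noteq> p \<and> H p y}" using h by blast
    moreover have "finite W" unfolding W_def using fin by simp
    ultimately have "card (?N p) \<le> card {y \<in> W. y \<noteq> p \<and> H p y}"
      by (intro card_inj_on_le) auto
    then show False using p unfolding W_def by simp
  qed
  show thesis
  proof (rule ccontr)
    assume n: "\<not> thesis"
    show False
      by (rule contra; (use n simplicial in blast | use n twins in blast | use n long_chain in blast |
        use n chord in blast | use n two_links in blast | use n short_link in blast))
  qed
qed

section \<open>Induced paths and cycles\<close>

definition adj :: "('a \<Rightarrow> 'a \<Rightarrow> bool) \<Rightarrow> 'a \<Rightarrow> 'a \<Rightarrow> bool" where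
  "adj A x y \<longleftrightarrow> A x y \<or> A y x"

lemma adj_sym: "adj A x y \<longleftrightarrow> adj A y x"
  by (auto simp: adj_def)

text \<open>
  Recursive forms, in which the neighbours of the first vertex are prescribed on the rest of the
  list; inserting vertices into a cycle next to its first vertex then only needs simplification.
\<close>

fun induced_path :: "('a \<Rightarrow> 'a \<Rightarrow> bool) \<Rightarrow> 'a list \<Rightarrow> bool" where
  "induced_path R [] \<longleftrightarrow> True"
| "induced_path R (x # p) \<longleftrightarrow> x \<notin> set p \<and> (\<forall>y\<in>set p. R x y \<longleftrightarrow> y = hd p) \<and> induced_path R p"

fun induced_cycle :: "('a \<Rightarrow> 'a \<Rightarrow> bool) \<Rightarrow> 'a list \<Rightarrow> bool" where
  "induced_cycle R [] \<longleftrightarrow> False"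
| "induced_cycle R (x # p) \<longleftrightarrow> 2 \<le> length p \<and> x \<notin> set p \<and>
    (\<forall>y\<in>set p. R x y \<longleftrightarrow> y = hd p \<or> y = last p) \<and> induced_path R p"

lemma induced_path_distinct: "induced_path R p \<Longrightarrow> distinct p"
  by (induction p) auto

lemma induced_cycle_distinct: "induced_cycle R p \<Longrightarrow> distinct p"
  by (cases p) (auto simp: induced_path_distinct)

lemma induced_path_append:
  "induced_path R (p @ q) \<longleftrightarrow> induced_path R p \<and> induced_path R q \<and> set p \<inter> set q = {} \<and>
    (\<forall>x\<in>set p. \<forall>y\<in>set q. R x y \<longleftrightarrow> x = last p \<and> y = hd q)"
proof (induction p)
  case (Cons x p)
  show ?case
  proof (cases "p = []")
    case False
    then have mem: "hd p \<in> set p" "last p \<in> set p" by auto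
    have "induced_path R ((x # p) @ q) \<longleftrightarrow> x \<notin> set p \<union> set q \<and>
        (\<forall>y\<in>set p. R x y \<longleftrightarrow> y = hd p) \<and> (\<forall>y\<in>set q. R x y \<longleftrightarrow> y = hd p) \<and> induced_path R (p @ q)"
      using False by auto
    also have "\<dots> \<longleftrightarrow> x \<notin> set p \<union> set q \<and> (\<forall>y\<in>set p. R x y \<longleftrightarrow> y = hd p) \<and>
        (\<forall>y\<in>set q. \<not> R x y) \<and> induced_path R (p @ q)"
    proof -
      have "(\<forall>y\<in>set q. R x y \<longleftrightarrow> y = hd p) \<longleftrightarrow> (\<forall>y\<in>set q. \<not> R x y)" if "set p \<inter> set q = {}"
        using that mem by (metis disjoint_iff)
      then show ?thesis unfolding Cons by (cases "set p \<inter> set q = {}") simp_all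
    qed
    also have "\<dots> \<longleftrightarrow> induced_path R (x # p) \<and> induced_path R q \<and> set (x # p) \<inter> set q = {} \<and>
        (\<forall>u\<in>set (x # p). \<forall>y\<in>set q. R u y \<longleftrightarrow> u = last (x # p) \<and> y = hd q)"
    proof (cases "x \<in> set p")
      case False
      then have "x \<noteq> last p" using mem by auto
      then have a: "(\<forall>u\<in>set (x # p). \<forall>y\<in>set q. R u y \<longleftrightarrow> u = last (x # p) \<and> y = hd q) \<longleftrightarrow>
          (\<forall>y\<in>set q. \<not> R x y) \<and> (\<forall>u\<in>set p. \<forall>y\<in>set q. R u y \<longleftrightarrow> u = last p \<and> y = hd q)"
        using \<open>p \<noteq> []\<close> by simp
      have b: "set (x # p) \<inter> set q = {} \<longleftrightarrow> x \<notin> set q \<and> set p \<inter> set q = {}" by auto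
      show ?thesis unfolding Cons a b induced_path.simps
        by (simp only: Un_iff de_Morgan_disj conj_ac)
    qed simp
    finally show ?thesis .
  qed (auto)
qed simp

lemma induced_path_rev:
  assumes "\<And>x y. R x y \<longleftrightarrow> R y x"
  shows "induced_path R (rev p) \<longleftrightarrow> induced_path R p"
proof (induction p)
  case (Cons x p)
  have "last (rev p) = hd p" by (simp add: last_rev)
  then show ?case using Cons assms by (auto simp: induced_path_append)
qed simp

lemma induced_cycle_rotate:
  assumes sym: "\<And>x y. R x y \<longleftrightarrow> R y x" and c: "induced_cycle R (x # p)"
  shows "induced_cycle R (p @ [x])"
proof -
  obtain y q where p: "p = y # q" "q \<noteq> []" using c by (cases p; cases "tl p") auto
  have mem: "hd q \<in> set q" "last q \<in> set q" using p by auto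
  have x: "x \<noteq> y" "x \<notin> set q" "\<forall>t\<in>set q. R x t \<longleftrightarrow> t = last q" "R x y"
    and y: "y \<notin> set q" "\<forall>t\<in>set q. R y t \<longleftrightarrow> t = hd q" and q: "induced_path R q"
    using c mem p(2) unfolding p(1) by auto
  have "\<forall>t\<in>set q. R t x \<longleftrightarrow> t = last q" "R y x" using x sym by blast+
  then have "induced_path R (q @ [x])" using q x(2) by (simp add: induced_path_append)
  moreover have "\<forall>t\<in>set (q @ [x]). R y t \<longleftrightarrow> t = hd (q @ [x]) \<or> t = last (q @ [x])"
    using y(2) x(2) \<open>R y x\<close> p(2) by auto
  ultimately show ?thesis using p x(1,2) y by (cases q) auto
qed

lemma induced_cycle_rotate_to:
  assumes sym: "\<And>x y. R x y \<longleftrightarrow> R y x" and c: "induced_cycle R (p @ a # q)"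
  shows "induced_cycle R (a # q @ p)"
  using c
proof (induction p arbitrary: q)
  case (Cons x p)
  then have "induced_cycle R ((p @ a # q) @ [x])" 
    using induced_cycle_rotate[where R = R, OF sym, of x "p @ a # q"] by simp
  then show ?case using Cons.IH[of "q @ [x]"] by simp
qed simp

text \<open>
  Rotate the cycle so that it starts in \<open>a\<close>, and reverse the rest if \<open>b\<close> comes last.
\<close>

lemma induced_cycle_start:
  assumes sym: "\<And>x y. R x y \<longleftrightarrow> R y x" and c: "induced_cycle R xs"
    and ab: "a \<in> set xs" "b \<in> set xs" "a \<noteq> b" "R a b"
  obtains q where "induced_cycle R (a # b # q)" "set (a # b # q) = set xs"
    "length (a # b # q) = length xs"
proof -
  obtain p q where xs: "xs = p @ a # q" using ab(1) by (meson split_list)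
  define r where "r = q @ p"
  have r: "induced_cycle R (a # r)" using induced_cycle_rotate_to[where R = R, OF sym, of p a q] c by (simp add: xs r_def)
  have sl: "set (a # r) = set xs" "length (a # r) = length xs" by (auto simp: xs r_def)
  then have "b \<in> set r" using ab by auto
  then have b: "b = hd r \<or> b = last r" and ne: "r \<noteq> []" using r ab by auto
  show thesis
  proof (cases "b = hd r")
    case True
    then show thesis using that[of "tl r"] r sl ne by simp
  next
    case False
    have "induced_cycle R (a # rev r)" using r by (auto simp: hd_rev last_rev induced_path_rev[where R = R, OF sym])
    moreover have "rev r = b # tl (rev r)" using False b ne by (metis hd_rev list.collapse rev_is_Nil_conv)
    ultimately show thesis using that[of "tl (rev r)"] sl by (metis length_Cons length_rev list.simps(15) set_rev)
  qed
qed

text \<open>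
  Cut the path at its first vertex that equals \<open>z\<close> or is adjacent to \<open>z\<close>.
\<close>

lemma induced_path_snoc_shorten:
  assumes "induced_path R p" "p \<noteq> []" "R (last p) z"
  shows "\<exists>q. induced_path R q \<and> q \<noteq> [] \<and> hd q = hd p \<and> last q = z \<and> set q \<subseteq> insert z (set p)"
  using assms
proof (induction p)
  case (Cons x p)
  consider "x = z" | "x \<noteq> z" "R x z" | "x \<noteq> z" "\<not> R x z" "p \<noteq> []" using Cons.prems by fastforce
  then show ?case
  proof cases
    case 1
    then show ?thesis by (intro exI[of _ "[x]"]) auto
  next
    case 2
    then show ?thesis by (intro exI[of _ "[x, z]"]) auto
  next
    case 3
    then obtain q where q: "induced_path R q" "q \<noteq> []" "hd q = hd p" "last q = z" "set q \<subseteq> insert z (set p)"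
      using Cons by auto
    then have "induced_path R (x # q)" using Cons.prems(1) 3 by auto
    then show ?thesis using q by (intro exI[of _ "x # q"]) auto
  qed
qed simp

lemma induced_path_exists:
  assumes "(\<lambda>x y. x \<in> Y \<and> y \<in> Y \<and> R x y)\<^sup>*\<^sup>* w z" "w \<in> Y"
  shows "\<exists>p. induced_path R p \<and> p \<noteq> [] \<and> hd p = w \<and> last p = z \<and> set p \<subseteq> Y"
  using assms
proof induction
  case base
  then show ?case by (intro exI[of _ "[w]"]) auto
next
  case (step y z)
  then obtain p where "induced_path R p" "p \<noteq> []" "hd p = w" "last p = y" "set p \<subseteq> Y" by auto
  then show ?case using induced_path_snoc_shorten[of R p z] step by auto
qed

lemma induced_path_alternating:
  assumes "induced_path R p" "p \<noteq> []"
    and "\<And>x y. \<lbrakk>x \<in> set p; y \<in> set p; R x y\<rbrakk> \<Longrightarrow> (x \<in> S) \<noteq> (y \<in> S)"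
  shows "odd (length p) \<longleftrightarrow> ((hd p \<in> S) = (last p \<in> S))"
  using assms
proof (induction p)
  case (Cons x p)
  show ?case
  proof (cases "p = []")
    case False
    then have "hd p \<in> set p" by simp
    then have "R x (hd p)" using Cons.prems(1) by auto
    then have "(x \<in> S) \<noteq> (hd p \<in> S)" using Cons.prems(3)[of x "hd p"] \<open>hd p \<in> set p\<close> by auto
    moreover have "odd (length p) \<longleftrightarrow> ((hd p \<in> S) = (last p \<in> S))"
      using Cons.IH Cons.prems False by auto
    ultimately show ?thesis using False by auto
  qed simp
qed simp

lemma induced_path_cong:
  assumes "\<And>x y. x \<in> set p \<Longrightarrow> y \<in> set p \<Longrightarrow> R x y \<longleftrightarrow> R' x y"
  shows "induced_path R p \<longleftrightarrow> induced_path R' p"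
  using assms by (induction p) simp_all

lemma induced_cycle_cong:
  assumes "\<And>x y. x \<in> set p \<Longrightarrow> y \<in> set p \<Longrightarrow> R x y \<longleftrightarrow> R' x y"
  shows "induced_cycle R p \<longleftrightarrow> induced_cycle R' p"
proof (cases p)
  case (Cons x q)
  have "induced_path R q \<longleftrightarrow> induced_path R' q" using assms Cons by (intro induced_path_cong) simp
  moreover have "R x y \<longleftrightarrow> R' x y" if "y \<in> set q" for y using assms Cons that by simp
  ultimately show ?thesis unfolding Cons by simp
qed simp


text \<open>
  The edge set of the induced subgraph on \<open>U\<close>, in the form that occurs in \<^const>\<open>underlying_graph\<close>.
\<close>

definition edge_set :: "('a \<Rightarrow> 'a \<Rightarrow> bool) \<Rightarrow> 'a set \<Rightarrow> 'a set set" where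
  "edge_set R U = {{u, v} | u v. u \<in> U \<and> v \<in> U \<and> R u v}"

lemma edge_set_insert:
  assumes R: "\<And>x y. R x y \<longleftrightarrow> R y x" "\<And>x. \<not> R x x"
  shows "edge_set R (set (x # p)) = edge_set R (set p) \<union> {{x, y} | y. y \<in> set p \<and> R x y}"
proof (intro equalityI subsetI)
  fix e assume "e \<in> edge_set R (set (x # p))"
  then obtain u v where e: "e = {u, v}" "u \<in> set (x # p)" "v \<in> set (x # p)" "R u v"
    unfolding edge_set_def by blast
  consider "u = x" "v \<in> set p" | "v = x" "u \<in> set p" | "u \<in> set p" "v \<in> set p"
    using e R(2) by auto
  then show "e \<in> edge_set R (set p) \<union> {{x, y} | y. y \<in> set p \<and> R x y}"
  proof cases
    case 1
    then show ?thesis using e by blast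
  next
    case 2
    then have "e = {x, u}" "R x u" using e R(1)[of u v] by (simp_all add: insert_commute)
    then show ?thesis using 2 by blast
  next
    case 3
    then show ?thesis using e(1,4) unfolding edge_set_def by blast
  qed
next
  fix e assume "e \<in> edge_set R (set p) \<union> {{x, y} | y. y \<in> set p \<and> R x y}"
  then show "e \<in> edge_set R (set (x # p))"
  proof
    assume "e \<in> edge_set R (set p)"
    then obtain u v where "e = {u, v}" "u \<in> set p" "v \<in> set p" "R u v"
      unfolding edge_set_def by blast
    then show ?thesis unfolding edge_set_def by (intro CollectI exI[of _ u] exI[of _ v]) simp
  next
    assume "e \<in> {{x, y} | y. y \<in> set p \<and> R x y}"
    then obtain y where "e = {x, y}" "y \<in> set p" "R x y" by blast
    then show ?thesis unfolding edge_set_def by (intro CollectI exI[of _ x] exI[of _ y]) simp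
  qed
qed

lemma induced_path_edges:
  assumes "\<And>x y. R x y \<longleftrightarrow> R y x" "\<And>x. \<not> R x x"
  shows "induced_path R p \<Longrightarrow> edge_set R (set p) = (\<lambda>i. {p ! i, p ! Suc i}) ` {i. Suc i < length p}"
proof (induction p)
  case (Cons x p)
  have "edge_set R (set (x # p)) = edge_set R (set p) \<union> {{x, y} | y. y \<in> set p \<and> R x y}"
    using assms by (rule edge_set_insert)
  also have "{{x, y} | y. y \<in> set p \<and> R x y} = (if p = [] then {} else {{x, hd p}})"
    using Cons.prems by auto
  also have "edge_set R (set p) = (\<lambda>i. {(x # p) ! i, (x # p) ! Suc i}) ` Suc ` {i. Suc i < length p}"
    using Cons by (simp add: image_image)
  also have "\<dots> \<union> (if p = [] then {} else {{x, hd p}}) = (\<lambda>i. {(x # p) ! i, (x # p) ! Suc i}) ` (Suc ` {i. Suc i < length p} \<union> (if p = [] then {} else {0}))"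
    by (auto simp: hd_conv_nth)
  also have "Suc ` {i. Suc i < length p} \<union> (if p = [] then {} else {0}) = {i. Suc i < length (x # p)}"
  proof -
    have "i \<in> Suc ` {i. Suc i < length p} \<union> (if p = [] then {} else {0}) \<longleftrightarrow> Suc i < length (x # p)" for i
      by (cases i) auto
    then show ?thesis by blast
  qed
  finally show ?case .
qed (simp add: edge_set_def)

lemma induced_cycle_edges:
  assumes R: "\<And>x y. R x y \<longleftrightarrow> R y x" "\<And>x. \<not> R x x" and c: "induced_cycle R xs"
  shows "mset_set (edge_set R (set xs)) =
    mset (map (\<lambda>i. {xs ! i, xs ! (Suc i mod length xs)}) [0..<length xs])"
proof -
  let ?n = "length xs"
  let ?e = "\<lambda>i. {xs ! i, xs ! (Suc i mod ?n)}"
  obtain x p where xs: "xs = x # p" using c by (metis induced_cycle.simps(1) neq_Nil_conv)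
  have p: "2 \<le> length p" "x \<notin> set p" "\<And>y. y \<in> set p \<Longrightarrow> R x y \<longleftrightarrow> y = hd p \<or> y = last p" "induced_path R p"
    using c unfolding xs induced_cycle.simps by blast+
  have ne: "p \<noteq> []" using p(1) by auto
  have "edge_set R (set xs) = edge_set R (set p) \<union> {{x, y} | y. y \<in> set p \<and> R x y}"
    unfolding xs using R by (rule edge_set_insert)
  also have "{{x, y} | y. y \<in> set p \<and> R x y} = {{x, hd p}, {x, last p}}"
    using p(3) hd_in_set[OF ne] last_in_set[OF ne] by blast
  also have "edge_set R (set p) = (\<lambda>i. {xs ! i, xs ! Suc i}) ` Suc ` {i. Suc i < length p}"
    using induced_path_edges[where R = R, OF R p(4)] by (simp add: image_image xs)
  also have "\<dots> = ?e ` Suc ` {i. Suc i < length p}"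
    by (intro image_cong) (auto simp: xs)
  also have "{{x, hd p}, {x, last p}} = ?e ` {0, length p}"
    using ne p(1) by (auto simp: xs hd_conv_nth last_conv_nth nth_Cons')
  also have "?e ` Suc ` {i. Suc i < length p} \<union> ?e ` {0, length p} = ?e ` (Suc ` {i. Suc i < length p} \<union> {0, length p})"
    by (simp only: image_Un)
  also have "Suc ` {i. Suc i < length p} \<union> {0, length p} = {..<?n}"
  proof (rule set_eqI)
    show "i \<in> Suc ` {i. Suc i < length p} \<union> {0, length p} \<longleftrightarrow> i \<in> {..<?n}" for i
      unfolding xs by (cases i) auto
  qed
  finally have set: "edge_set R (set xs) = ?e ` {..<?n}" .
  have d: "distinct xs" using induced_cycle_distinct[OF c] .
  have n: "3 \<le> ?n" using p(1) xs by simp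
  have "inj_on ?e {..<?n}"
  proof (rule inj_onI)
    fix i j assume ij: "i \<in> {..<?n}" "j \<in> {..<?n}" "?e i = ?e j"
    have lt: "i < ?n" "j < ?n" using ij by simp_all
    have m: "Suc i mod ?n < ?n" "Suc j mod ?n < ?n" using n by (intro mod_less_divisor; linarith)+
    from ij(3) have "xs ! i = xs ! j \<or> (xs ! i = xs ! (Suc j mod ?n) \<and> xs ! (Suc i mod ?n) = xs ! j)"
      by (auto simp only: doubleton_eq_iff)
    then consider "i = j" | "i = Suc j mod ?n" "Suc i mod ?n = j"
      using d m lt by (metis nth_eq_iff_index_eq)
    then show "i = j"
    proof cases
      case 2
      have mod: "Suc t mod ?n = 0 \<and> Suc t = ?n \<or> Suc t mod ?n = Suc t" if "t < ?n" for t
        using that by (simp add: mod_Suc)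
      have "i = 0 \<and> Suc j = ?n \<or> i = Suc j" "j = 0 \<and> Suc i = ?n \<or> j = Suc i"
        using mod[OF lt(2)] mod[OF lt(1)] unfolding 2(1)[symmetric] 2(2) by blast+
      then show ?thesis using n by linarith
    qed
  qed
  then have "mset_set (?e ` {..<?n}) = image_mset ?e (mset_set {..<?n})"
    by (rule image_mset_mset_set[symmetric])
  also have "mset_set {..<?n} = mset [0..<?n]" by (simp only: mset_upt lessThan_atLeast0)
  finally show ?thesis by (simp only: set mset_map)
qed

section \<open>Stable sets\<close>

definition stable :: "('a \<Rightarrow> 'a \<Rightarrow> bool) \<Rightarrow> 'a set \<Rightarrow> bool" where
  "stable R T \<longleftrightarrow> (\<forall>x\<in>T. \<forall>y\<in>T. \<not> R x y)"

lemma stable_subset: "stable R T \<Longrightarrow> T' \<subseteq> T \<Longrightarrow> stable R T'"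
  unfolding stable_def by blast

lemma stable_union:
  assumes "\<And>x y. R x y \<longleftrightarrow> R y x" "stable R T" "stable R Z" "\<And>x y. x \<in> Z \<Longrightarrow> y \<in> T \<Longrightarrow> \<not> R x y"
  shows "stable R (T \<union> Z)"
  unfolding stable_def
proof (intro ballI)
  fix x y assume "x \<in> T \<union> Z" "y \<in> T \<union> Z"
  then show "\<not> R x y" using assms unfolding stable_def by (metis Un_iff)
qed

text \<open>
  The usual exchange along a component of the bipartite graph on \<open>S \<union> T\<close>: if the component \<open>K\<close> of \<open>w\<close>
  misses \<open>z\<close>, then swapping \<open>S\<close> and \<open>T\<close> on \<open>K\<close> preserves the total size and separates \<open>w\<close> from \<open>z\<close>.
  If it contains \<open>z\<close>, a shortest path alternates between \<open>S\<close> and \<open>T\<close> and hence has even length.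
\<close>

lemma alternating_path_or_exchange:
  assumes sym: "\<And>x y. R x y \<longleftrightarrow> R y x" and fin: "finite S" "finite T" and st: "stable R S" "stable R T"
    and wz: "w \<in> S - T" "z \<in> S - T"
  obtains (path) p where "induced_path R p" "p \<noteq> []" "hd p = w" "last p = z" "set p \<subseteq> S \<union> T" "odd (length p)"
  | (exchange) S1 S2 where "stable R S1" "stable R S2" "S1 \<subseteq> S \<union> T" "S2 \<subseteq> S \<union> T"
      "w \<notin> S1" "z \<notin> S2" "card S1 + card S2 = card S + card T"
proof -
  let ?r = "\<lambda>x y. x \<in> S \<union> T \<and> y \<in> S \<union> T \<and> R x y"
  define K where "K = {y. ?r\<^sup>*\<^sup>* w y}"
  have wK: "w \<in> K" unfolding K_def by simp
  have closed: "y \<in> K" if "x \<in> K" "x \<in> S \<union> T" "y \<in> S \<union> T" "R x y" for x y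
    using that unfolding K_def by (auto intro: rtranclp.rtrancl_into_rtrancl)
  show thesis
  proof (cases "z \<in> K")
    case True
    then obtain p where p: "induced_path R p" "p \<noteq> []" "hd p = w" "last p = z" "set p \<subseteq> S \<union> T"
      using induced_path_exists[of "S \<union> T" R w z] wz(1) unfolding K_def by blast
    have "(x \<in> S) \<noteq> (y \<in> S)" if "x \<in> set p" "y \<in> set p" "R x y" for x y
      using that st p(5) unfolding stable_def by blast
    then have "odd (length p)" using induced_path_alternating[OF p(1,2), of S] p(3,4) wz by blast
    with p show thesis by (rule path)
  next
    case False
    let ?S1 = "(S - K) \<union> (T \<inter> K)" and ?S2 = "(S \<inter> K) \<union> (T - K)"
    have "\<not> R x y" if "x \<in> T \<inter> K" "y \<in> S - K" for x y using that closed by blast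
    then have 1: "stable R ?S1"
      using st by (intro stable_union[OF sym]) (auto intro: stable_subset)
    have "\<not> R x y" if "x \<in> T - K" "y \<in> S \<inter> K" for x y using that closed sym by blast
    then have 2: "stable R ?S2"
      using st by (intro stable_union[OF sym]) (auto intro: stable_subset)
    have "card ?S1 = card (S - K) + card (T \<inter> K)" "card ?S2 = card (S \<inter> K) + card (T - K)"
      using fin by (auto intro!: card_Un_disjoint)
    moreover have "card S = card (S - K) + card (S \<inter> K)" "card T = card (T - K) + card (T \<inter> K)"
      using fin by (subst card_Un_disjoint[symmetric]; auto intro!: arg_cong[where f = card])+
    ultimately have "card ?S1 + card ?S2 = card S + card T" by simp
    with 1 2 show thesis using wz wK False by (intro exchange[of ?S1 ?S2]) auto
  qed
qed

section \<open>Path partitions and removable sets\<close>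

definition be_path :: "('a \<Rightarrow> 'a \<Rightarrow> bool) \<Rightarrow> 'a set \<Rightarrow> 'a list \<Rightarrow> bool" where
  "be_path A S p \<longleftrightarrow> p \<noteq> [] \<and> distinct p \<and> successively A p \<and> (\<exists>x. set p \<inter> S = {x} \<and> x \<in> {hd p, last p})"

definition be_partition :: "('a \<Rightarrow> 'a \<Rightarrow> bool) \<Rightarrow> 'a set \<Rightarrow> 'a set \<Rightarrow> 'a list set \<Rightarrow> bool" where
  "be_partition A V S P \<longleftrightarrow> (\<forall>p\<in>P. be_path A S p) \<and> \<Union> (set ` P) = V \<and>
    (\<forall>p\<in>P. \<forall>q\<in>P. p \<noteq> q \<longrightarrow> set p \<inter> set q = {})"

lemma be_partition_single: "be_path A S p \<Longrightarrow> be_partition A (set p) S {p}"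
  unfolding be_partition_def by simp

lemma be_partition_union:
  assumes P: "be_partition A X S P" and Q: "be_partition A Y S Q" and XY: "X \<inter> Y = {}"
  shows "be_partition A (X \<union> Y) S (P \<union> Q)"
proof -
  have "set p \<subseteq> X" if "p \<in> P" for p using P that unfolding be_partition_def by blast
  moreover have "set p \<subseteq> Y" if "p \<in> Q" for p using Q that unfolding be_partition_def by blast
  ultimately have "set p \<inter> set q = {}" if "p \<in> P" "q \<in> Q" for p q using that XY by blast
  then show ?thesis using P Q unfolding be_partition_def by (auto simp: Int_commute) blast+
qed

lemma be_path_edge:
  assumes "adj A a b" "a \<noteq> b" "a \<in> S" "b \<notin> S"
  obtains p where "be_path A S p" "set p = {a, b}"
proof -
  have S: "{a, b} \<inter> S = {a}" using assms by auto
  have "be_path A S [a, b] \<or> be_path A S [b, a]"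
    using assms(1,2) S unfolding adj_def be_path_def by (auto simp: insert_commute)
  then show thesis using that[of "[a, b]"] that[of "[b, a]"] by auto
qed

text \<open>
  For \<open>a \<in> C\<close>: the vertex \<open>a\<close> is a source or a sink of the subdigraph induced by \<open>C\<close>.
\<close>

definition one_sided :: "('a \<Rightarrow> 'a \<Rightarrow> bool) \<Rightarrow> 'a set \<Rightarrow> 'a \<Rightarrow> bool" where
  "one_sided A C a \<longleftrightarrow> (\<forall>y\<in>C. \<not> A y a) \<or> (\<forall>y\<in>C. \<not> A a y)"

text \<open>
  The statement proved by induction speaks of one fixed \<open>S\<close>, and it forbids only those blocking odd
  cycles whose two special vertices both lie outside \<open>S\<close>. This weaker hypothesis is essential: the
  contraction used below can create a blocking odd cycle, but every new one has a special vertex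
  in \<open>S\<close>. The special vertices are required to be adjacent instead of being the first two of the
  list, so that the condition does not depend on where the list starts.
\<close>

locale be_instance =
  fixes A :: "'a \<Rightarrow> 'a \<Rightarrow> bool" and V S :: "'a set"
  assumes fin: "finite V"
    and irrefl: "\<not> A x x"
    and width: "partial_k_tree 2 V (adj A)"
    and SV: "S \<subseteq> V"
    and S_stable: "stable (adj A) S"
    and S_max: "\<lbrakk>T \<subseteq> V; stable (adj A) T\<rbrakk> \<Longrightarrow> card T \<le> card S"
    and no_block: "\<lbrakk>induced_cycle (adj A) xs; odd (length xs); set xs \<subseteq> V; a \<in> set xs - S; b \<in> set xs - S;
        adj A a b; one_sided A (set xs) a; one_sided A (set xs) b\<rbrakk> \<Longrightarrow> False"
begin

lemma adj_irrefl: "\<not> adj A x x"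
  unfolding adj_def using irrefl by simp

lemma adj_neq: "adj A x y \<Longrightarrow> x \<noteq> y"
  using adj_irrefl by blast

lemma finS: "finite S"
  using SV fin finite_subset by blast

lemma S_dominates:
  assumes "x \<in> V" "x \<notin> S"
  shows "\<exists>y\<in>nbrs (adj A) V x. y \<in> S"
proof (rule ccontr)
  assume "\<not> ?thesis"
  then have "\<not> adj A x y" if "y \<in> S" for y using that SV unfolding nbrs_def by blast
  then have "stable (adj A) (S \<union> {x})"
    using S_stable adj_irrefl by (intro stable_union[OF adj_sym]) (auto simp: stable_def)
  then have "card (S \<union> {x}) \<le> card S" using SV assms(1) by (intro S_max) auto
  then show False using assms(2) finS by simp
qed

lemma restrict:
  assumes "X \<subseteq> V" "\<And>T. \<lbrakk>T \<subseteq> V - X; stable (adj A) T\<rbrakk> \<Longrightarrow> card T + card (S \<inter> X) \<le> card S"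
  shows "be_instance A (V - X) (S - X)"
proof
  show "partial_k_tree 2 (V - X) (adj A)" using width by (rule partial_k_tree_subgraph) auto
  show "card T \<le> card (S - X)" if "T \<subseteq> V - X" "stable (adj A) T" for T
    using assms(2)[OF that] card_Diff_subset_Int[of S X] finS by simp
  show False if "induced_cycle (adj A) xs" "odd (length xs)" "set xs \<subseteq> V - X" "a \<in> set xs - (S - X)" "b \<in> set xs - (S - X)"
        "adj A a b" "one_sided A (set xs) a" "one_sided A (set xs) b" for xs a b
    by (rule no_block[of xs a b]) (use that in auto)
qed (use fin irrefl SV S_stable in \<open>auto intro: stable_subset\<close>)

text \<open>
  If no Hamiltonian path of the triangle starts or ends in \<open>s\<close>, then \<open>c\<close> and \<open>d\<close> are a source and a
  sink of the triangle, which is a blocking odd cycle.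
\<close>

lemma triangle_path:
  assumes V: "{s, c, d} \<subseteq> V" and adj: "adj A s c" "adj A s d" "adj A c d" and S: "s \<in> S" "c \<notin> S" "d \<notin> S"
  obtains p where "be_path A S p" "set p = {s, c, d}"
proof -
  have ne: "s \<noteq> c" "s \<noteq> d" "c \<noteq> d" using adj adj_neq by auto
  have S': "{s, c, d} \<inter> S = {s}" using S by auto
  have "A s c \<and> A c d \<or> A s d \<and> A d c \<or> A c d \<and> A d s \<or> A d c \<and> A c s"
  proof (rule ccontr)
    assume "\<not> ?thesis"
    then have "one_sided A (set [s, c, d]) c" "one_sided A (set [s, c, d]) d"
      using adj irrefl unfolding one_sided_def adj_def by auto
    moreover have "induced_cycle (adj A) [s, c, d]" using ne adj by auto
    ultimately show False using no_block[of "[s, c, d]" c d] V S adj(3) by auto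
  qed
  then have "be_path A S [s, c, d] \<or> be_path A S [s, d, c] \<or> be_path A S [c, d, s] \<or> be_path A S [d, c, s]"
    using ne S' unfolding be_path_def by (auto simp: insert_commute)
  then show thesis
    using that[of "[s, c, d]"] that[of "[s, d, c]"] that[of "[c, d, s]"] that[of "[d, c, s]"]
    by (auto simp: insert_commute)
qed

end

text \<open>
  The induction step: \<open>smaller\<close> is the induction hypothesis. It ranges over all arc relations because
  a contraction changes the arcs.
\<close>

locale be_step = be_instance A V S for A :: "'a \<Rightarrow> 'a \<Rightarrow> bool" and V S +
  assumes smaller: "\<lbrakk>card V' < card V; be_instance A' V' S'\<rbrakk> \<Longrightarrow> \<exists>P. be_partition (A' :: 'a \<Rightarrow> 'a \<Rightarrow> bool) V' S' P"
begin

lemma remove: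
  assumes Q: "be_partition A X S Q" and X: "X \<subseteq> V" "X \<noteq> {}"
    and T: "\<And>T. \<lbrakk>T \<subseteq> V - X; stable (adj A) T\<rbrakk> \<Longrightarrow> card T + card (S \<inter> X) \<le> card S"
  shows "\<exists>P. be_partition A V S P"
proof -
  have "card (V - X) < card V" using X fin by (intro psubset_card_mono) auto
  then obtain P where P: "be_partition A (V - X) (S - X) P"
    using smaller restrict[OF X(1) T] by blast
  have sub: "set p \<subseteq> V - X" if "p \<in> P" for p using P that unfolding be_partition_def by blast
  have "be_path A S p" if "p \<in> P" for p
  proof -
    have "set p \<inter> S = set p \<inter> (S - X)" using sub[OF that] by blast
    then show ?thesis using P that unfolding be_partition_def be_path_def by simp
  qed
  then have "be_partition A (V - X) S P" using P unfolding be_partition_def by blast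
  from be_partition_union[OF this Q] show ?thesis using X(1) by (metis Diff_disjoint Diff_partition Int_commute sup_commute)
qed

text \<open>
  Every stable set outside \<open>X\<close> can be enlarged by \<open>Z\<close>, which gives the bound required for removing \<open>X\<close>.
\<close>

lemma remove_with_closed:
  assumes Q: "be_partition A X S Q" and X: "X \<subseteq> V" "X \<noteq> {}"
    and Z: "Z \<subseteq> X" "stable (adj A) Z" "\<And>x. x \<in> Z \<Longrightarrow> nbrs (adj A) V x \<subseteq> X" "card (S \<inter> X) \<le> card Z"
  shows "\<exists>P. be_partition A V S P"
proof (rule remove[OF Q X])
  fix T assume T: "T \<subseteq> V - X" "stable (adj A) T"
  have "\<not> adj A x y" if "x \<in> Z" "y \<in> T" for x y using that Z(3)[of x] T(1) unfolding nbrs_def by blast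
  then have "stable (adj A) (T \<union> Z)" using T(2) Z(2) by (intro stable_union[OF adj_sym])
  then have "card (T \<union> Z) \<le> card S" using T(1) X Z by (intro S_max) auto
  moreover have "card (T \<union> Z) = card T + card Z"
  proof (rule card_Un_disjoint)
    show "finite T" "finite Z" using T Z X fin by (meson Diff_subset finite_subset order_trans)+
    show "T \<inter> Z = {}" using T Z by blast
  qed
  ultimately show "card T + card (S \<inter> X) \<le> card S" using Z(4) by simp
qed

lemma remove_path:
  assumes p: "be_path A S p" "set p \<subseteq> V" and x: "x \<in> set p" "nbrs (adj A) V x \<subseteq> set p"
  shows "\<exists>P. be_partition A V S P"
proof (rule remove_with_closed[of _ _ "{x}"])
  show "be_partition A (set p) S {p}" using p(1) by (rule be_partition_single)
  show "card (S \<inter> set p) \<le> card {x}" using p(1) unfolding be_path_def by (auto simp: Int_commute)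
qed (use p x adj_irrefl in \<open>auto simp: stable_def be_path_def\<close>)

text \<open>
  The closed neighbourhood of \<open>x\<close> is a clique of at most three vertices that meets \<open>S\<close>, and it is
  spanned by a path with an end in \<open>S\<close>.
\<close>

lemma simplicial_step:
  assumes x: "x \<in> V" "card (nbrs (adj A) V x) \<le> 2"
    and clique: "\<And>a b. \<lbrakk>a \<in> nbrs (adj A) V x; b \<in> nbrs (adj A) V x; a \<noteq> b\<rbrakk> \<Longrightarrow> adj A a b"
  shows "\<exists>P. be_partition A V S P"
proof -
  let ?N = "nbrs (adj A) V x"
  have N: "y \<in> ?N \<longleftrightarrow> y \<in> V \<and> adj A x y" for y unfolding nbrs_def by simp
  have finN: "finite ?N" unfolding nbrs_def using fin by simp
  consider "?N = {}" | a where "?N = {a}" | a b where "?N = {a, b}" "a \<noteq> b"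
  proof -
    consider "card ?N = 0" | "card ?N = 1" | "card ?N = 2" using x(2) by linarith
    then show thesis
    proof cases
      case 1
      then show thesis using that(1) finN by simp
    next
      case 2
      then show thesis using that(2) by (auto simp: card_1_singleton_iff)
    next
      case 3
      then show thesis using that(3) by (auto simp: card_2_iff)
    qed
  qed
  then have "\<exists>p. be_path A S p \<and> set p = insert x ?N"
  proof cases
    case 1
    then have "x \<in> S" using S_dominates[OF x(1)] by auto
    then have "be_path A S [x]" unfolding be_path_def by simp
    then show ?thesis using 1 by (intro exI[of _ "[x]"]) simp
  next
    case (2 a)
    then have a: "a \<in> V" "adj A x a" "adj A a x" using N[of a] adj_sym[of A] by auto
    show ?thesis
    proof (cases "x \<in> S")
      case True
      then have "a \<notin> S" using a S_stable unfolding stable_def by blast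
      from be_path_edge[OF a(2) adj_neq[OF a(2)] True this] show ?thesis using 2 by metis
    next
      case False
      then have "a \<in> S" using S_dominates[OF x(1) False] 2 by auto
      from be_path_edge[OF a(3) adj_neq[OF a(3)] this False] show ?thesis using 2 by (metis insert_commute)
    qed
  next
    case (3 a b)
    then have ab: "a \<in> V" "b \<in> V" "adj A x a" "adj A x b" "adj A a b" using N[of a] N[of b] clique[of a b] by auto
    have ba: "adj A a x" "adj A b x" "adj A b a" using ab adj_sym[of A] by auto
    have st: "\<And>y z. y \<in> S \<Longrightarrow> adj A y z \<Longrightarrow> z \<notin> S" using S_stable unfolding stable_def by blast
    have "x \<in> S \<or> a \<in> S \<or> b \<in> S" using S_dominates[OF x(1)] unfolding 3(1) by blast
    then show ?thesis
    proof (elim disjE)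
      assume s: "x \<in> S"
      obtain p where "be_path A S p" "set p = {x, a, b}"
        by (rule triangle_path[of x a b]) (use s st ab ba x in auto)
      then show ?thesis using 3 by auto
    next
      assume s: "a \<in> S"
      obtain p where "be_path A S p" "set p = {a, x, b}"
        by (rule triangle_path[of a x b]) (use s st ab ba x in auto)
      then show ?thesis using 3 by (auto simp: insert_commute)
    next
      assume s: "b \<in> S"
      obtain p where "be_path A S p" "set p = {b, x, a}"
        by (rule triangle_path[of b x a]) (use s st ab ba x in auto)
      then show ?thesis using 3 by (auto simp: insert_commute)
    qed
  qed
  then obtain p where "be_path A S p" "set p = insert x ?N" by blast
  then show ?thesis using x(1) N by (intro remove_path[of p x]) auto
qed

text \<open>
  By maximality \<open>S\<close> contains \<open>x\<close> and \<open>y\<close>, or else \<open>a\<close> and \<open>b\<close>: otherwise exchanging \<open>a\<close> and \<open>b\<close> for \<open>x\<close>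
  and \<open>y\<close> would enlarge it. In both cases the edges \<open>xa\<close> and \<open>yb\<close> can be removed.
\<close>

lemma twins_step:
  assumes xy: "x \<in> V" "y \<in> V" "x \<noteq> y" and ab: "a \<noteq> b"
    and N: "nbrs (adj A) V x = {a, b}" "nbrs (adj A) V y = {a, b}"
  shows "\<exists>P. be_partition A V S P"
proof -
  have Nx: "adj A x t \<longleftrightarrow> t = a \<or> t = b" and Ny: "adj A y t \<longleftrightarrow> t = a \<or> t = b" if "t \<in> V" for t
    using N that unfolding nbrs_def by blast+
  have abV: "a \<in> V" "b \<in> V" using N(1) unfolding nbrs_def by blast+
  have ne: "x \<noteq> a" "x \<noteq> b" "y \<noteq> a" "y \<noteq> b" using Nx Ny abV adj_irrefl by blast+
  have xa: "adj A x a" "adj A a x" "adj A y b" "adj A b y" "adj A x b" "adj A y a" using Nx Ny abV adj_sym[of A] by blast+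
  have st: "\<And>y z. y \<in> S \<Longrightarrow> adj A y z \<Longrightarrow> z \<notin> S" using S_stable unfolding stable_def by blast
  have nxy: "\<not> adj A x y" using Nx[OF xy(2)] ne by blast
  have stZ: "stable (adj A) {x, y}" using nxy adj_irrefl adj_sym[of A x y] unfolding stable_def by blast
  have "x \<in> S \<and> a \<notin> S \<and> y \<in> S \<and> b \<notin> S \<or> a \<in> S \<and> x \<notin> S \<and> b \<in> S \<and> y \<notin> S"
  proof (cases "x \<in> S \<or> y \<in> S")
    case True
    then have "a \<notin> S" "b \<notin> S" using st xa by blast+
    then have "x \<in> S" "y \<in> S" using S_dominates[OF xy(1)] S_dominates[OF xy(2)] unfolding N by blast+
    then show ?thesis using \<open>a \<notin> S\<close> \<open>b \<notin> S\<close> by blast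
  next
    case False
    have "card (S - {a, b} \<union> {x, y}) \<le> card S"
    proof (rule S_max)
      show "stable (adj A) (S - {a, b} \<union> {x, y})"
        using stZ Nx Ny SV S_stable by (intro stable_union[OF adj_sym]) (auto intro: stable_subset)
    qed (use SV xy in auto)
    moreover have "card (S - {a, b} \<union> {x, y}) = card (S - {a, b}) + 2"
      using False finS xy(3) by (subst card_Un_disjoint) auto
    moreover have "card (S - {a, b}) + card (S \<inter> {a, b}) = card S"
      using card_Diff_subset_Int[of S "{a, b}"] finS card_mono[of S "S \<inter> {a, b}"] by simp
    ultimately have "card {a, b} \<le> card (S \<inter> {a, b})" using ab by simp
    then have "S \<inter> {a, b} = {a, b}" by (intro card_seteq) auto
    then show ?thesis using False by blast
  qed
  then obtain p q where p: "be_path A S p" "set p = {x, a}" and q: "be_path A S q" "set q = {y, b}"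
    and c: "S \<inter> {x, a, y, b} = {x, y} \<or> S \<inter> {x, a, y, b} = {a, b}"
  proof (elim disjE conjE)
    assume s: "x \<in> S" "a \<notin> S" "y \<in> S" "b \<notin> S"
    then have "S \<inter> {x, a, y, b} = {x, y}" by auto
    then show thesis using that be_path_edge[of A x a S] be_path_edge[of A y b S] s xa ne by metis
  next
    assume s: "a \<in> S" "x \<notin> S" "b \<in> S" "y \<notin> S"
    then have "S \<inter> {x, a, y, b} = {a, b}" by auto
    then show thesis using that be_path_edge[of A a x S] be_path_edge[of A b y S] s xa ne
      by (metis insert_commute)
  qed
  have "be_partition A (set p \<union> set q) S ({p} \<union> {q})"
    using p q ne xy ab by (intro be_partition_union be_partition_single) auto
  moreover have "set p \<union> set q = {x, a, y, b}" using p q by auto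
  ultimately have P: "be_partition A {x, a, y, b} S ({p} \<union> {q})" by simp
  have "card (S \<inter> {x, a, y, b}) = card {x, y}" using c xy ab by auto
  then show ?thesis using stZ N xy abV
    by (intro remove_with_closed[OF P, of "{x, y}"]) auto
qed

end

section \<open>Chains with two inner vertices\<close>

context be_instance begin

lemma link_facts:
  assumes "link (adj A) V w v u z"
  shows "v \<in> V" "u \<in> V" "w \<in> V" "z \<in> V" "distinct [w, v, u, z]"
    "adj A w v" "adj A v w" "adj A v u" "adj A u v" "adj A u z" "adj A z u"
    "\<And>y. y \<in> V \<Longrightarrow> adj A v y \<longleftrightarrow> y = u \<or> y = w" "\<And>y. y \<in> V \<Longrightarrow> adj A u y \<longleftrightarrow> y = v \<or> y = z"
    "\<And>y. y \<in> V \<Longrightarrow> adj A y v \<longleftrightarrow> y = u \<or> y = w" "\<And>y. y \<in> V \<Longrightarrow> adj A y u \<longleftrightarrow> y = v \<or> y = z"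
proof -
  have L: "v \<in> V" "u \<in> V" "nbrs (adj A) V v = {u, w}" "nbrs (adj A) V u = {v, z}" "w \<noteq> z" "w \<noteq> u" "z \<noteq> v"
    using assms unfolding link_def by auto
  show V: "v \<in> V" "u \<in> V" "w \<in> V" "z \<in> V" using L unfolding nbrs_def by blast+
  show v: "adj A v y \<longleftrightarrow> y = u \<or> y = w" and u: "adj A u y \<longleftrightarrow> y = v \<or> y = z" if "y \<in> V" for y
    using L(3,4) that unfolding nbrs_def by blast+
  then show "adj A y v \<longleftrightarrow> y = u \<or> y = w" "adj A y u \<longleftrightarrow> y = v \<or> y = z" if "y \<in> V" for y
    using that adj_sym[of A y] by simp_all
  show "adj A v w" "adj A v u" "adj A u v" "adj A u z" using v u V by simp_all
  then show "adj A w v" "adj A z u" using adj_sym[of A] by simp_all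
  then show "distinct [w, v, u, z]" using L \<open>adj A v u\<close> adj_neq by auto
qed

lemma S_nonadj: "x \<in> S \<Longrightarrow> adj A x y \<Longrightarrow> y \<notin> S"
  using S_stable unfolding stable_def by blast

lemma stable_insert:
  assumes "stable (adj A) T" "T \<subseteq> V" "nbrs (adj A) V x \<inter> T = {}"
  shows "stable (adj A) (insert x T)"
proof -
  have "stable (adj A) (T \<union> {x})"
    using assms adj_irrefl by (intro stable_union[OF adj_sym]) (auto simp: stable_def nbrs_def)
  then show ?thesis by simp
qed

lemma card_bound_insert:
  assumes T: "stable (adj A) T" "T \<subseteq> V" and x: "x \<in> V" "x \<notin> T" "nbrs (adj A) V x \<inter> T = {}"
  shows "card T + 1 \<le> card S"
proof -
  have "finite T" using T fin finite_subset by blast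
  moreover have "card (insert x T) \<le> card S"
    using stable_insert[OF T x(3)] T x by (intro S_max) auto
  ultimately show ?thesis using x(2) by simp
qed

text \<open>
  A stable set that avoids one end of a link can be enlarged by the inner vertex next to that end.
\<close>

lemma card_bound_link:
  assumes L: "link (adj A) V w v u z" and T: "stable (adj A) T" "T \<subseteq> V - {v, u}" and wz: "w \<notin> T \<or> z \<notin> T"
  shows "card T + 1 \<le> card S"
proof -
  have N: "nbrs (adj A) V v = {u, w}" "nbrs (adj A) V u = {v, z}" "v \<in> V" "u \<in> V" using L unfolding link_def by auto
  from wz show ?thesis
  proof
    assume "w \<notin> T"
    then show ?thesis using T N by (intro card_bound_insert[of T v]) auto
  next
    assume "z \<notin> T"
    then show ?thesis using T N by (intro card_bound_insert[of T u]) auto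
  qed
qed

lemma uncovered_link_ends:
  assumes L: "link (adj A) V w v u z" and S: "v \<notin> S" "u \<notin> S"
  shows "w \<in> S" "z \<in> S"
  using S_dominates[of v] S_dominates[of u] L S unfolding link_def by auto

text \<open>
  Apply the exchange to \<open>S\<close> and \<open>T\<close>. Both exchanged sets avoid an end of the link and could be
  enlarged by an inner vertex, so their total size is at most \<open>2 * card S - 2\<close>. As \<open>T\<close> is too large
  for this, the alternating path exists.
\<close>

lemma even_path_between_link_ends:
  assumes L: "link (adj A) V w v u z" and S: "v \<notin> S" "u \<notin> S"
    and T: "T \<subseteq> V - {w, v, u, z}" "stable (adj A) T" "card S \<le> card T + 1"
  obtains p where "induced_path (adj A) p" "p \<noteq> []" "hd p = w" "last p = z" "set p \<subseteq> V - {v, u}" "odd (length p)"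
proof -
  note wz = uncovered_link_ends[OF L S]
  have finT: "finite T" using T fin by (meson Diff_subset finite_subset)
  have "w \<in> S - T" "z \<in> S - T" using T wz by auto
  then consider (path) p where "induced_path (adj A) p" "p \<noteq> []" "hd p = w" "last p = z" "set p \<subseteq> S \<union> T" "odd (length p)"
    | (exchange) S1 S2 where "stable (adj A) S1" "stable (adj A) S2" "S1 \<subseteq> S \<union> T" "S2 \<subseteq> S \<union> T"
      "w \<notin> S1" "z \<notin> S2" "card S1 + card S2 = card S + card T"
    using alternating_path_or_exchange[OF adj_sym finS finT S_stable T(2)] by metis
  then show thesis
  proof cases
    case path
    then show thesis using T(1) SV S by (intro that[of p]) auto
  next
    case exchange
    have "S1 \<subseteq> V - {v, u}" "S2 \<subseteq> V - {v, u}" using exchange(3,4) T(1) SV S by auto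
    then have "card S1 + 1 \<le> card S" "card S2 + 1 \<le> card S"
      using exchange card_bound_link[OF L] by blast+
    then show thesis using exchange(7) T(3) by linarith
  qed
qed

text \<open>
  If the conclusion fails, each of \<open>v\<close> and \<open>u\<close> has only outgoing or only incoming arcs. The link
  closes the even path from \<open>w\<close> to \<open>z\<close> to an odd induced cycle, which is then blocked by \<open>v\<close> and \<open>u\<close>.
\<close>

lemma uncovered_link_directed:
  assumes L: "link (adj A) V w v u z" and S: "v \<notin> S" "u \<notin> S"
    and T: "T \<subseteq> V - {w, v, u, z}" "stable (adj A) T" "card S \<le> card T + 1"
  shows "A w v \<and> A v u \<or> A u v \<and> A v w \<or> A z u \<and> A u v \<or> A v u \<and> A u z"
proof (rule ccontr)
  assume nd: "\<not> ?thesis"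
  obtain p where p: "induced_path (adj A) p" "p \<noteq> []" "hd p = w" "last p = z" "set p \<subseteq> V - {v, u}" "odd (length p)"
    using even_path_between_link_ends[OF assms] .
  note F = link_facts[OF L]
  have ne: "w \<noteq> z" "v \<noteq> u" "w \<noteq> v" "u \<noteq> w" "z \<noteq> v" "z \<noteq> u" using F(5) by auto
  let ?xs = "v # u # rev p"
  have xsV: "set ?xs \<subseteq> V" using p(5) F by auto
  have ip: "induced_path (adj A) (rev p)" using p(1) induced_path_rev[where R = "adj A", OF adj_sym] by simp
  have "\<forall>y\<in>set (rev p). adj A u y \<longleftrightarrow> y = hd (rev p)"
  proof
    fix y assume "y \<in> set (rev p)"
    then have "y \<in> V" "y \<noteq> v" using p(5) by auto
    then show "adj A u y \<longleftrightarrow> y = hd (rev p)" using F(13) p(4) by (simp add: hd_rev)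
  qed
  then have "induced_path (adj A) (u # rev p)" using ip p(5) by auto
  moreover have "\<forall>y\<in>set (u # rev p). adj A v y \<longleftrightarrow> y = hd (u # rev p) \<or> y = last (u # rev p)"
  proof
    fix y assume "y \<in> set (u # rev p)"
    then have "y \<in> V" using xsV by auto
    then show "adj A v y \<longleftrightarrow> y = hd (u # rev p) \<or> y = last (u # rev p)"
      using F(12) p(2,3) by (simp add: last_rev)
  qed
  moreover have "2 \<le> length (u # rev p)" using p(2) by (cases p) auto
  moreover have "v \<notin> set (u # rev p)" using p(5) ne by auto
  ultimately have c: "induced_cycle (adj A) ?xs" by simp
  have side: "A w v \<or> A v w" "A v u \<or> A u v" "A u z \<or> A z u" using F unfolding adj_def by auto
  have onV: "y = u \<or> y = w" if "y \<in> set ?xs" "A v y \<or> A y v" for y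
    using that F(12)[of y] xsV unfolding adj_def by blast
  have onU: "y = v \<or> y = z" if "y \<in> set ?xs" "A u y \<or> A y u" for y
    using that F(13)[of y] xsV unfolding adj_def by blast
  have "(\<not> A u v \<and> \<not> A w v) \<or> (\<not> A v u \<and> \<not> A v w)" "(\<not> A v u \<and> \<not> A z u) \<or> (\<not> A u v \<and> \<not> A u z)"
    using nd side by blast+
  then have "one_sided A (set ?xs) v" "one_sided A (set ?xs) u"
    unfolding one_sided_def using onV onU by metis+
  moreover have "odd (length ?xs)" using p(6) by simp
  ultimately show False using no_block[OF c _ xsV, of v u] S F(8) by simp
qed

end

context be_step begin

text \<open>
  Removing the edge \<open>vu\<close> can only fail because of stable sets that contain both ends of the link.
\<close>

lemma remove_link:
  assumes L: "link (adj A) V w v u z" and S: "v \<in> S \<or> u \<in> S"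
    and T: "\<And>T. \<lbrakk>T \<subseteq> V - {v, u}; stable (adj A) T; w \<in> T; z \<in> T\<rbrakk> \<Longrightarrow> card T + 1 \<le> card S"
  shows "\<exists>P. be_partition A V S P"
proof -
  note F = link_facts[OF L]
  have ne: "v \<noteq> u" "u \<noteq> v" using F(5) by auto
  have "\<exists>p. be_path A S p \<and> set p = {v, u}"
  proof (cases "v \<in> S")
    case True
    then show ?thesis using be_path_edge[OF F(8) ne(1) True S_nonadj[OF True F(8)]] by metis
  next
    case False
    then show ?thesis using be_path_edge[OF F(9) ne(2) _ False] S by (metis insert_commute)
  qed
  then obtain p where p: "be_path A S p" "set p = {v, u}" by blast
  have "card (S \<inter> {v, u}) = 1" using p unfolding be_path_def by (auto simp: Int_commute)
  then show ?thesis
    using be_partition_single[OF p(1)] card_bound_link[OF L] T F(1,2) unfolding p(2)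
    by (intro remove[of "{v, u}" "{p}"]) auto
qed

text \<open>
  If stable sets outside the link are small, the edges \<open>wv\<close> and \<open>zu\<close> can be removed. Otherwise one of
  the paths \<open>w v u\<close> and \<open>z u v\<close> is directed, and it can be removed as it contains the neighbourhood
  of its middle vertex and has its only vertex of \<open>S\<close> at an end.
\<close>

lemma uncovered_link_step:
  assumes L: "link (adj A) V w v u z" and S: "v \<notin> S" "u \<notin> S"
  shows "\<exists>P. be_partition A V S P"
proof (cases "\<exists>T. T \<subseteq> V - {w, v, u, z} \<and> stable (adj A) T \<and> card S \<le> card T + 1")
  case True
  note F = link_facts[OF L] and wz = uncovered_link_ends[OF L S]
  have N: "nbrs (adj A) V v = {u, w}" "nbrs (adj A) V u = {v, z}" using L unfolding link_def by auto
  have ne: "distinct [w, v, u]" "distinct [u, v, w]" "distinct [z, u, v]" "distinct [v, u, z]" using F(5) by auto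
  have Sw: "{w, v, u} \<inter> S = {w}" "{z, u, v} \<inter> S = {z}" using wz S by auto
  from True have "A w v \<and> A v u \<or> A u v \<and> A v w \<or> A z u \<and> A u v \<or> A v u \<and> A u z"
    using uncovered_link_directed[OF L S] by blast
  then have "be_path A S [w, v, u] \<or> be_path A S [u, v, w] \<or> be_path A S [z, u, v] \<or> be_path A S [v, u, z]"
    using Sw ne unfolding be_path_def by (auto simp: insert_commute)
  then show ?thesis
    using remove_path[of "[w, v, u]" v] remove_path[of "[u, v, w]" v] remove_path[of "[z, u, v]" u]
      remove_path[of "[v, u, z]" u] N F(1-4) by auto
next
  case False
  note F = link_facts[OF L] and wz = uncovered_link_ends[OF L S]
  have ne: "w \<noteq> v" "z \<noteq> u" "w \<noteq> z" "w \<noteq> u" "v \<noteq> z" "v \<noteq> u" using F(5) by auto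
  obtain p where p: "be_path A S p" "set p = {w, v}" using be_path_edge[OF F(6) ne(1) wz(1) S(1)] .
  obtain q where q: "be_path A S q" "set q = {z, u}" using be_path_edge[OF F(11) ne(2) wz(2) S(2)] .
  have "be_partition A (set p \<union> set q) S ({p} \<union> {q})"
    using p q ne by (intro be_partition_union be_partition_single) auto
  moreover have "set p \<union> set q = {w, v, u, z}" using p q by auto
  ultimately have P: "be_partition A {w, v, u, z} S ({p} \<union> {q})" by simp
  have "S \<inter> {w, v, u, z} = {w, z}" using wz S by auto
  then have "card (S \<inter> {w, v, u, z}) = 2" using ne by simp
  then show ?thesis using False F(1-4) by (intro remove[OF P]) (auto simp: not_le)
qed

lemma chord_step:
  assumes L: "link (adj A) V w v u z" and c: "adj A w z"
  shows "\<exists>P. be_partition A V S P"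
proof (cases "v \<in> S \<or> u \<in> S")
  case True
  show ?thesis by (rule remove_link[OF L True]) (use c in \<open>auto simp: stable_def\<close>)
qed (use uncovered_link_step[OF L] in blast)

text \<open>
  If \<open>S\<close> meets the edge \<open>vu\<close>, this edge can be removed: a stable set that contains both \<open>w\<close> and \<open>z\<close> would grow if \<open>w\<close> were
  replaced by \<open>v\<close> and \<open>v'\<close>.
\<close>

lemma two_links_step:
  assumes L: "link (adj A) V w v u z" and L': "link (adj A) V w v' u' z" and ne: "v \<noteq> v'"
  shows "\<exists>P. be_partition A V S P"
proof (cases "v \<in> S \<or> u \<in> S")
  case True
  note F = link_facts[OF L] and F' = link_facts[OF L']
  have N: "nbrs (adj A) V v = {u, w}" "nbrs (adj A) V v' = {u', w}" using L L' unfolding link_def by auto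
  have "v' \<noteq> u" using F'(6) F(13)[of w] F(3,5) adj_sym[of A] by auto
  show ?thesis
  proof (rule remove_link[OF L True])
    fix T assume T: "T \<subseteq> V - {v, u}" "stable (adj A) T" "w \<in> T" "z \<in> T"
    have no: "v' \<notin> T" "u' \<notin> T" "u \<notin> T" "v \<notin> T" using T F'(6,11) unfolding stable_def by auto
    have finT: "finite T" using T fin by (meson Diff_subset finite_subset)
    have st: "stable (adj A) (insert v (T - {w}))"
      using T N no by (intro stable_insert) (auto intro: stable_subset)
    have "card (insert v (T - {w})) + 1 \<le> card S"
    proof (rule card_bound_insert[OF st])
      show "v' \<notin> insert v (T - {w})" using no ne by auto
      have "u' \<noteq> v" using F'(15)[of w] F(6) F(3) F'(5) by auto
      then show "nbrs (adj A) V v' \<inter> insert v (T - {w}) = {}" using N(2) no F(5) by auto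
    qed (use T F F' in auto)
    moreover have "card (insert v (T - {w})) = card T"
      using no finT T(3) card_gt_0_iff[of T] by (auto simp: card_Diff_singleton)
    ultimately show "card T + 1 \<le> card S" by simp
  qed
qed (use uncovered_link_step[OF L] in blast)

end

section \<open>Contracting a chain\<close>

lemma successively_difference:
  assumes "successively A' p" "\<not> successively A p"
  obtains p1 x y p2 where "p = p1 @ x # y # p2" "A' x y" "\<not> A x y"
proof -
  have "\<exists>p1 x y p2. p = p1 @ x # y # p2 \<and> A' x y \<and> \<not> A x y"
    using assms
  proof (induction p rule: induct_list012)
    case (3 x y p)
    show ?case
    proof (cases "A x y")
      case True
      then obtain p1 s t p2 where "y # p = p1 @ s # t # p2" "A' s t" "\<not> A s t" using 3 by auto
      then show ?thesis by (metis append_Cons)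
    next
      case False
      then have "A' x y" "x # y # p = [] @ x # y # p" using 3 by auto
      then show ?thesis using False by blast
    qed
  qed auto
  then show thesis using that by blast
qed

text \<open>
  The arcs after contracting the link \<open>w v u z\<close> to a single edge \<open>wz\<close> that inherits its orientation
  from the edge \<open>wv\<close>.
\<close>

definition contract_arcs :: "('a \<Rightarrow> 'a \<Rightarrow> bool) \<Rightarrow> 'a \<Rightarrow> 'a \<Rightarrow> 'a \<Rightarrow> 'a \<Rightarrow> 'a \<Rightarrow> bool" where
  "contract_arcs A w v z x y \<longleftrightarrow> A x y \<or> x = w \<and> y = z \<and> A w v \<or> x = z \<and> y = w \<and> A v w"

lemma adj_contract_arcs:
  "adj A w v \<Longrightarrow> adj (contract_arcs A w v z) x y \<longleftrightarrow> adj A x y \<or> x = w \<and> y = z \<or> x = z \<and> y = w"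
  unfolding adj_def contract_arcs_def by blast

context be_instance begin

text \<open>
  A stable set of the contracted digraph misses \<open>w\<close> or \<open>z\<close> and can be enlarged in the original by \<open>v\<close>
  or \<open>u\<close>. A blocked odd cycle that uses the edge \<open>wz\<close> becomes an odd induced cycle of the original
  when the link is put back. Its special vertices differ from \<open>z \<in> S\<close>, and every other vertex of the
  cycle has the same orientations at it as before, since \<open>wv\<close> is oriented like \<open>wz\<close>.
\<close>

lemma contract_link_instance:
  assumes L: "link (adj A) V w v u z" and S: "v \<in> S" "z \<in> S" and nwz: "\<not> adj A w z"
  shows "be_instance (contract_arcs A w v z) (V - {v, u}) (S - {v})"
proof -
  let ?A = "contract_arcs A w v z"
  note F = link_facts[OF L]
  have ne: "w \<noteq> v" "z \<noteq> u" "w \<noteq> z" "w \<noteq> u" "v \<noteq> z" "v \<noteq> u" using F(5) by auto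
  have SN: "u \<notin> S" "w \<notin> S" using S_nonadj[OF S(1)] F(7,8) by auto
  have adjA: "adj ?A x y \<longleftrightarrow> adj A x y \<or> x = w \<and> y = z \<or> x = z \<and> y = w" for x y
    using adj_contract_arcs[OF F(6)] .
  have old: "?A x y \<longleftrightarrow> A x y" if "{x, y} \<noteq> {w, z}" for x y
    using that unfolding contract_arcs_def by auto
  have old_adj: "adj ?A x y \<longleftrightarrow> adj A x y" if "{x, y} \<noteq> {w, z}" for x y
    using that unfolding adjA by auto
  show ?thesis
  proof
    show "finite (V - {v, u})" using fin by simp
    show "\<not> ?A x x" for x using irrefl ne unfolding contract_arcs_def by auto
    show "S - {v} \<subseteq> V - {v, u}" using SV SN by auto
    show "stable (adj ?A) (S - {v})" using S_stable SN unfolding stable_def adjA by auto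
    \<comment> \<open>Contracting \<open>v\<close> into \<open>w\<close> and \<open>u\<close> into \<open>z\<close> turns the edge \<open>vu\<close> into \<open>wz\<close>.\<close>
    define f where "f x = (if x = v then w else z)" for x
    have f: "f v = w" "f u = z" unfolding f_def using ne by simp_all
    show "partial_k_tree 2 (V - {v, u}) (adj ?A)"
    proof (rule partial_k_tree_contract[OF width, where f = f])
      show "f x \<in> V - {v, u} \<and> adj A x (f x)" if "x \<in> {v, u}" for x
        using that f F ne by auto
      show "\<exists>s\<in>V. \<exists>t\<in>V. adj A s t \<and> override_on id f {v, u} s = p \<and> override_on id f {v, u} t = q"
        if pq: "p \<in> V - {v, u}" "q \<in> V - {v, u}" "adj ?A p q" for p q
      proof -
        consider "adj A p q" | "p = w" "q = z" | "p = z" "q = w" using pq(3) unfolding adjA by blast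
        then show ?thesis
        proof cases
          case 1
          then show ?thesis using pq by (intro bexI[of _ p] bexI[of _ q]) auto
        next
          case 2
          then show ?thesis using F f by (intro bexI[of _ v] bexI[of _ u]) auto
        next
          case 3
          then show ?thesis using F f by (intro bexI[of _ u] bexI[of _ v]) auto
        qed
      qed
    qed (use F in auto)
    show "card T \<le> card (S - {v})" if T: "T \<subseteq> V - {v, u}" "stable (adj ?A) T" for T
    proof -
      have "w \<notin> T \<or> z \<notin> T" "stable (adj A) T" using T(2) unfolding stable_def adjA by blast+
      then have "card T + 1 \<le> card S" using card_bound_link[OF L _ T(1)] by blast
      then show ?thesis using S(1) finS by simp
    qed
    fix xs a b
    assume c: "induced_cycle (adj ?A) xs" "odd (length xs)" and xsV: "set xs \<subseteq> V - {v, u}"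
      and a: "a \<in> set xs - (S - {v})" and b: "b \<in> set xs - (S - {v})" and ab: "adj ?A a b"
      and side: "one_sided ?A (set xs) a" "one_sided ?A (set xs) b"
    have abS: "a \<in> set xs - S" "b \<in> set xs - S" "a \<noteq> z" "b \<noteq> z" using a b S xsV by auto
    then have "adj A a b" using ab adjA by blast
    show False
    proof (cases "w \<in> set xs \<and> z \<in> set xs")
      case False
      then have "{x, y} \<noteq> {w, z}" if "x \<in> set xs" "y \<in> set xs" for x y using that by auto
      then have "adj ?A x y \<longleftrightarrow> adj A x y" if "x \<in> set xs" "y \<in> set xs" for x y using old_adj that by simp
      then have "induced_cycle (adj A) xs" using c(1) induced_cycle_cong[of xs "adj ?A" "adj A"] by simp
      moreover have "one_sided A (set xs) a" "one_sided A (set xs) b"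
        using side unfolding one_sided_def contract_arcs_def by blast+
      ultimately show False using no_block[of xs a b] c(2) xsV abS \<open>adj A a b\<close> by blast
    next
      case True
      then obtain q where q: "induced_cycle (adj ?A) (w # z # q)" "set (w # z # q) = set xs" "length (w # z # q) = length xs"
        using induced_cycle_start[where R = "adj ?A", OF adj_sym c(1), of w z] ne adjA by blast
      let ?ys = "w # v # u # z # q"
      have q0: "q \<noteq> []" "w \<notin> set q" "z \<notin> set q" using q(1) by auto
      have qV: "set q \<subseteq> V" "v \<notin> set q" "u \<notin> set q" using q(2) xsV by auto
      have "induced_path (adj ?A) (z # q)" using q(1) by simp
      moreover have "{x, y} \<noteq> {w, z}" if "x \<in> set (z # q)" "y \<in> set (z # q)" for x y
        using that q0 ne by auto
      then have "adj ?A x y \<longleftrightarrow> adj A x y" if "x \<in> set (z # q)" "y \<in> set (z # q)" for x y using old_adj that by blast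
      ultimately have zq: "induced_path (adj A) (z # q)" using induced_path_cong[of "z # q" "adj ?A" "adj A"] by simp
      have uy: "\<forall>y\<in>set (z # q). adj A u y \<longleftrightarrow> y = z" using qV F(13) ne F(4) by auto
      have vy: "\<forall>y\<in>set (u # z # q). adj A v y \<longleftrightarrow> y = u" using qV q0(2) F ne by auto
      have wy: "\<forall>y\<in>set (v # u # z # q). adj A w y \<longleftrightarrow> y = v \<or> y = last q"
      proof
        fix y assume y: "y \<in> set (v # u # z # q)"
        have lq: "last q \<in> set q" using q0 by simp
        show "adj A w y \<longleftrightarrow> y = v \<or> y = last q"
        proof (cases "y \<in> set q")
          case True
          then have "y \<noteq> z" "y \<noteq> w" "y \<noteq> v" using q0 qV by auto
          then have "adj A w y \<longleftrightarrow> adj ?A w y" using adjA ne by blast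
          also have "\<dots> \<longleftrightarrow> y = last q" using q(1) True q0 \<open>y \<noteq> z\<close> by simp
          finally show ?thesis using \<open>y \<noteq> v\<close> by simp
        next
          case False
          then have "y \<noteq> last q" using lq by auto
          moreover have "\<not> adj A w u" using F(15)[OF F(3)] ne by simp
          ultimately show ?thesis using y F(6) nwz False ne by auto
        qed
      qed
      have cyc: "induced_cycle (adj A) ?ys"
        using zq uy vy wy q0 qV ne by simp
      have setys: "set ?ys = insert v (insert u (set xs))" using q(2) by auto
      have side': "one_sided A (set ?ys) x" if x: "x \<in> set xs - S" "x \<noteq> z" "one_sided ?A (set xs) x" for x
      proof -
        have xV: "x \<in> V" "x \<noteq> v" "x \<noteq> u" using x xsV by auto
        have nu: "\<not> A x u" "\<not> A u x" using F(15)[OF xV(1)] xV x(2) unfolding adj_def by auto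
        have "A x v \<Longrightarrow> \<exists>y\<in>set xs. ?A x y" "A v x \<Longrightarrow> \<exists>y\<in>set xs. ?A y x"
          using F(14)[OF xV(1)] xV x(2) True unfolding adj_def contract_arcs_def by blast+
        moreover have "A x y \<Longrightarrow> ?A x y" "A y x \<Longrightarrow> ?A y x" for y unfolding contract_arcs_def by auto
        ultimately show ?thesis using x(3) nu unfolding one_sided_def setys by (metis insert_iff)
      qed
      have "odd (length ?ys)" using q(3) c(2) by (metis even_Suc length_Cons)
      moreover have "set ?ys \<subseteq> V" using setys xsV F by auto
      ultimately show False
        using no_block[OF cyc] side'[OF abS(1,3) side(1)] side'[OF abS(2,4) side(2)] abS \<open>adj A a b\<close>
        unfolding setys by blast
    qed
  qed
qed

text \<open>
  If no path uses the new edge, the path on \<open>v\<close> and \<open>u\<close> is added. Otherwise the path that uses it ends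
  or starts in \<open>z\<close>, because \<open>z \<in> S\<close>; replacing \<open>z\<close> by \<open>v\<close> there gives a path with \<open>v \<in> S\<close> at that end,
  and \<open>z\<close> and \<open>u\<close> form a further path.
\<close>

lemma lift_contracted_partition:
  assumes L: "link (adj A) V w v u z" and S: "v \<in> S" "z \<in> S" 
    and P: "be_partition (contract_arcs A w v z) (V - {v, u}) (S - {v}) P"
  shows "\<exists>P. be_partition A V S P"
proof -
  let ?A = "contract_arcs A w v z"
  note F = link_facts[OF L]
  have ne: "w \<noteq> v" "z \<noteq> u" "w \<noteq> z" "w \<noteq> u" "v \<noteq> z" "v \<noteq> u" using F(5) by auto
  have SN: "u \<notin> S" "w \<notin> S" using S_nonadj[OF S(1)] F(7,8) by auto
  have paths: "be_path ?A (S - {v}) p" if "p \<in> P" for p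
    using P that unfolding be_partition_def by simp
  have cover: "\<Union> (set ` P) = V - {v, u}" using P unfolding be_partition_def by simp
  have disjoint: "set p \<inter> set q = {}" if "p \<in> P" "q \<in> P" "p \<noteq> q" for p q
    using P that unfolding be_partition_def by simp
  have sub: "set p \<subseteq> V - {v, u}" if "p \<in> P" for p using cover that by blast
  have pth: "be_path A S p" if p: "p \<in> P" "successively A p" for p
  proof -
    have "set p \<inter> S = set p \<inter> (S - {v})" using sub[OF p(1)] by blast
    then show ?thesis using paths[OF p(1)] p(2) unfolding be_path_def by simp
  qed
  show ?thesis
  proof (cases "\<forall>p\<in>P. successively A p")
    case True
    then have "be_partition A (V - {v, u}) S P" using cover disjoint pth unfolding be_partition_def by simp
    moreover obtain p where p: "be_path A S p" "set p = {v, u}" using be_path_edge[OF F(8) ne(6) S(1) SN(1)] .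
    ultimately have "be_partition A (V - {v, u} \<union> set p) S (P \<union> {p})"
      using p by (intro be_partition_union be_partition_single) auto
    moreover have "V - {v, u} \<union> set p = V" using p(2) F by auto
    ultimately show ?thesis by auto
  next
    case False
    then obtain p where p: "p \<in> P" "\<not> successively A p" by blast
    note bp = paths[OF p(1)]
    then obtain p1 x y p2 where pp: "p = p1 @ x # y # p2" "?A x y" "\<not> A x y"
      using successively_difference[of ?A p A] p unfolding be_path_def by blast
    have xy: "x = w \<and> y = z \<and> A w v \<or> x = z \<and> y = w \<and> A v w" using pp(2,3) unfolding contract_arcs_def by blast
    have zp: "z \<in> set p" and "w \<in> set p" using xy pp(1) by auto
    obtain s where s: "set p \<inter> (S - {v}) = {s}" "s \<in> {hd p, last p}" using bp unfolding be_path_def by blast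
    have only: "t = s" if "t \<in> set p" "t \<in> S" for t
    proof -
      have "t \<in> set p \<inter> (S - {v})" using that sub[OF p(1)] by blast
      then show ?thesis unfolding s(1) by simp
    qed
    then have "s = z" using zp S(2) by simp
    have dp: "distinct p" "successively ?A p" using bp unfolding be_path_def by auto
    have noz: "successively A r" if "successively ?A r" "z \<notin> set r" for r
      using that by (induction r rule: induct_list012) (auto simp: contract_arcs_def)
    have "\<exists>q. be_path A S q \<and> set q = insert v (set p - {z})"
      using xy
    proof (elim disjE conjE)
      assume e: "x = w" "y = z" "A w v"
      have "z \<noteq> hd p" using dp(1) unfolding pp(1) e by (cases p1) auto
      then have "last p = z" using s(2) \<open>s = z\<close> by auto
      then have p2: "p2 = []" using dp(1) unfolding pp(1) e by (cases p2 rule: rev_cases) auto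
      have "z \<notin> set (p1 @ [w])" using dp(1) unfolding pp(1) e by auto
      moreover have "successively ?A (p1 @ [w])" using dp(2) unfolding pp(1) e p2 by (simp add: successively_append_iff)
      ultimately have "successively A (p1 @ [w])" using noz by blast
      then have "successively A ((p1 @ [w]) @ [v])" using e(3) by (subst successively_append_iff) simp
      moreover have "set ((p1 @ [w]) @ [v]) = insert v (set p - {z})"
        using dp(1) unfolding pp(1) e p2 by auto
      moreover have "distinct ((p1 @ [w]) @ [v])" using dp(1) sub[OF p(1)] unfolding pp(1) e p2 by auto
      moreover have "set ((p1 @ [w]) @ [v]) \<inter> S = {v}" unfolding calculation(2) using only \<open>s = z\<close> S(1) by blast
      ultimately show ?thesis unfolding be_path_def by (intro exI[of _ "(p1 @ [w]) @ [v]"]) auto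
    next
      assume e: "x = z" "y = w" "A v w"
      have "z \<noteq> last p" using dp(1) unfolding pp(1) e by (cases p2 rule: rev_cases) auto
      then have "hd p = z" using s(2) \<open>s = z\<close> by auto
      then have p1: "p1 = []" using dp(1) unfolding pp(1) e by (cases p1) auto
      have "z \<notin> set (w # p2)" using dp(1) unfolding pp(1) e by auto
      moreover have "successively ?A (w # p2)" using dp(2) unfolding pp(1) e p1 by simp
      ultimately have "successively A (w # p2)" using noz by blast
      then have "successively A (v # w # p2)" using e(3) by simp
      moreover have "set (v # w # p2) = insert v (set p - {z})"
        using dp(1) unfolding pp(1) e p1 by auto
      moreover have "distinct (v # w # p2)" using dp(1) sub[OF p(1)] unfolding pp(1) e p1 by auto
      moreover have "set (v # w # p2) \<inter> S = {v}" unfolding calculation(2) using only \<open>s = z\<close> S(1) by blast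
      ultimately show ?thesis unfolding be_path_def by (intro exI[of _ "v # w # p2"]) auto
    qed
    then obtain q where q: "be_path A S q" "set q = insert v (set p - {z})" by blast
    obtain r where r: "be_path A S r" "set r = {z, u}" using be_path_edge[OF F(11) ne(2) S(2) SN(1)] .
    have disj: "set t \<inter> set p = {}" if "t \<in> P - {p}" for t
      using disjoint[of t p] that p(1) by simp
    have "successively A t" if t: "t \<in> P - {p}" for t
    proof (rule noz)
      show "successively ?A t" using paths[of t] t unfolding be_path_def by simp
      show "z \<notin> set t" using disj[OF t] zp by blast
    qed
    moreover have "\<Union> (set ` (P - {p})) = V - {v, u} - set p"
      using cover disj p(1) by blast
    ultimately have "be_partition A (V - {v, u} - set p) S (P - {p})"
      using disjoint pth unfolding be_partition_def by simp
    moreover have "be_partition A (set q \<union> set r) S ({q} \<union> {r})"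
      using q r ne sub[OF p(1)] by (intro be_partition_union be_partition_single) auto
    moreover have "(V - {v, u} - set p) \<inter> (set q \<union> set r) = {}" using q(2) r(2) zp by auto
    ultimately have "be_partition A ((V - {v, u} - set p) \<union> (set q \<union> set r)) S (P - {p} \<union> ({q} \<union> {r}))"
      by (rule be_partition_union)
    moreover have "(V - {v, u} - set p) \<union> (set q \<union> set r) = V"
      using q(2) r(2) zp sub[OF p(1)] F by auto
    ultimately show ?thesis by auto
  qed
qed

end

section \<open>The induction\<close>

context be_step begin

lemma contract_step:
  assumes L: "link (adj A) V w v u z" and S: "v \<in> S" "z \<in> S"
  shows "\<exists>P. be_partition A V S P"
proof (cases "adj A w z")
  case False
  have "card (V - {v, u}) < card V" using link_facts(1)[OF L] fin by (intro psubset_card_mono) auto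
  then obtain P where "be_partition (contract_arcs A w v z) (V - {v, u}) (S - {v}) P"
    using smaller contract_link_instance[OF L S False] by blast
  then show ?thesis using lift_contracted_partition[OF L S] by blast
qed (use chord_step[OF L] in blast)

text \<open>
  If \<open>S\<close> avoids two consecutive inner vertices or contains two vertices at distance two, an earlier
  step applies. In the remaining case \<open>t2\<close> could be exchanged for \<open>t1\<close> and \<open>t3\<close>, contrary to the
  choice of \<open>S\<close>.
\<close>

lemma long_chain_step:
  assumes L: "link (adj A) V a t1 t2 t3" and L': "link (adj A) V t1 t2 t3 b"
  shows "\<exists>P. be_partition A V S P"
proof -
  note F = link_facts[OF L] and F' = link_facts[OF L']
  have rev_link: "link (adj A) V t3 t2 t1 a" using L by (simp add: link_sym)
  consider "t1 \<notin> S" "t2 \<notin> S" | "t2 \<notin> S" "t3 \<notin> S" | "t1 \<in> S" "t3 \<in> S" | "t2 \<in> S" "a \<in> S" | "t2 \<in> S" "b \<in> S"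
    | "t2 \<in> S" "t1 \<notin> S" "t3 \<notin> S" "a \<notin> S" "b \<notin> S"
    using S_nonadj F(8,10) by blast
  then show ?thesis
  proof cases
    case 6
    have "card (insert t1 (S - {t2})) + 1 \<le> card S"
    proof (rule card_bound_insert)
      show "stable (adj A) (insert t1 (S - {t2}))"
        using 6 L SV S_stable by (intro stable_insert) (auto intro: stable_subset simp: link_def)
      show "nbrs (adj A) V t3 \<inter> insert t1 (S - {t2}) = {}" using 6 L' F'(5) unfolding link_def by auto
    qed (use 6 SV F F' in auto)
    moreover have "card (insert t1 (S - {t2})) = card S" using 6 finS card_gt_0_iff[of S] by (auto simp: card_Diff_singleton)
    ultimately show ?thesis by simp
  qed (use uncovered_link_step[OF L] uncovered_link_step[OF L'] contract_step[OF L] contract_step[OF rev_link] contract_step[OF L'] in blast)+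
qed

text \<open>
  The critical case is \<open>z \<notin> S\<close> with \<open>u\<close> being a source or a sink. Then \<open>x \<in> S\<close>, and the cycle \<open>u z x w v\<close>
  is induced, so it is not blocked by \<open>u\<close> and \<open>z\<close>. Hence \<open>x z u\<close> is a directed path in one of the two
  directions, and it can be removed together with the edge \<open>vw\<close>.
\<close>

lemma short_link_step_oriented:
  assumes L: "link (adj A) V w v u z" and x: "x \<in> V" "nbrs (adj A) V x = {w, z}" and S: "v \<in> S"
  shows "\<exists>P. be_partition A V S P"
proof -
  note F = link_facts[OF L]
  have ne: "w \<noteq> v" "z \<noteq> u" "w \<noteq> z" "w \<noteq> u" "v \<noteq> z" "v \<noteq> u" using F(5) by auto
  have Nx: "adj A x y \<longleftrightarrow> y = w \<or> y = z" if "y \<in> V" for y using x(2) that unfolding nbrs_def by blast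
  have xa: "adj A x w" "adj A x z" using Nx F by auto
  then have xne: "x \<noteq> w" "x \<noteq> z" using adj_neq by auto
  have "x \<noteq> v" "x \<noteq> u" using Nx[OF F(2)] Nx[OF F(1)] F(8,9) ne by auto
  note xne = xne this
  have N: "nbrs (adj A) V v = {u, w}" "nbrs (adj A) V u = {v, z}" using L unfolding link_def by auto
  have SN: "u \<notin> S" "w \<notin> S" using S_nonadj[OF S] F(7,8) by auto
  consider (z) "z \<in> S" | (chord) "adj A w z" | (dir) "z \<notin> S" "A v u \<and> A u z \<or> A z u \<and> A u v"
    | (undir) "z \<notin> S" "\<not> adj A w z" "\<not> (A v u \<and> A u z)" "\<not> (A z u \<and> A u v)" by blast
  then show ?thesis
  proof cases
    case z
    then show ?thesis using contract_step[OF L S] by blast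
  next
    case chord
    then show ?thesis using chord_step[OF L] by blast
  next
    case dir
    have S3: "{v, u, z} \<inter> S = {v}" using dir S SN by auto
    have "be_path A S [v, u, z] \<or> be_path A S [z, u, v]"
      using S3 dir(2) ne unfolding be_path_def by (auto simp: insert_commute)
    then show ?thesis using remove_path[of "[v, u, z]" u] remove_path[of "[z, u, v]" u] N F(1-4) by auto
  next
    case undir
    have xS: "x \<in> S" using S_dominates[OF x(1)] x(2) undir(1) SN by auto
    have nxv: "\<not> adj A x v" "\<not> adj A x u" using Nx F(1,2) ne by auto
    let ?C = "[u, z, x, w, v]"
    have CV: "set ?C \<subseteq> V" using F(1-4) x(1) by auto
    have "\<not> adj A z v" using F(14)[OF F(4)] ne by auto
    moreover have "\<not> adj A z w" "adj A z x" using undir(2) xa adj_sym[of A] by blast+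
    moreover have "\<not> adj A u w" "\<not> adj A u x" using F(13)[OF F(3)] F(13)[OF x(1)] ne xne by auto
    ultimately have cyc: "induced_cycle (adj A) ?C"
      using F(6,9,10) xa nxv ne xne by auto
    have side: "A v u \<or> A u v" "A u z \<or> A z u" using F unfolding adj_def by auto
    have onU: "y = v \<or> y = z" if "y \<in> set ?C" "A u y \<or> A y u" for y
      using that F(13)[of y] CV unfolding adj_def by blast
    have onZ: "y = u \<or> y = x" if "y \<in> set ?C" "A z y \<or> A y z" for y
      using that \<open>\<not> adj A z v\<close> \<open>\<not> adj A z w\<close> irrefl unfolding adj_def by auto
    have uv: "(\<not> A u v \<and> \<not> A u z) \<or> (\<not> A v u \<and> \<not> A z u)" using undir side by blast
    then have "one_sided A (set ?C) u" unfolding one_sided_def using onU by metis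
    then have nz: "\<not> one_sided A (set ?C) z"
      using no_block[OF cyc _ CV, of u z] SN undir(1) F(10) by auto
    have "A x z \<and> A z u \<or> A u z \<and> A z x"
    proof (rule ccontr)
      assume "\<not> ?thesis"
      then have "(\<not> A u z \<and> \<not> A x z) \<or> (\<not> A z u \<and> \<not> A z x)" using uv side undir by blast
      then have "one_sided A (set ?C) z" unfolding one_sided_def using onZ by metis
      then show False using nz by blast
    qed
    moreover have S3: "{x, z, u} \<inter> S = {x}" using undir xS SN by auto
    ultimately have "be_path A S [x, z, u] \<or> be_path A S [u, z, x]"
      using ne xne unfolding be_path_def by (auto simp: insert_commute)
    then obtain p where p: "be_path A S p" "set p = {x, z, u}"
      by (metis (no_types, opaque_lifting) empty_set insert_commute list.simps(15))
    obtain q where q: "be_path A S q" "set q = {v, w}" using be_path_edge[OF F(7) ne(1)[symmetric] S SN(2)] .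
    have "be_partition A (set p \<union> set q) S ({p} \<union> {q})"
      using p q ne xne by (intro be_partition_union be_partition_single) auto
    moreover have "set p \<union> set q = {x, z, u, v, w}" using p q by auto
    ultimately have P: "be_partition A {x, z, u, v, w} S ({p} \<union> {q})" by simp
    have "S \<inter> {x, z, u, v, w} = {x, v}" using undir xS S SN by auto
    moreover have "stable (adj A) {x, v}" using nxv adj_irrefl adj_sym[of A x v] unfolding stable_def by blast
    ultimately show ?thesis using N x F(1-4)
      by (intro remove_with_closed[OF P, of "{x, v}"]) auto
  qed
qed

lemma short_link_step:
  assumes L: "link (adj A) V w v u z" and x: "x \<in> V" "nbrs (adj A) V x = {w, z}"
  shows "\<exists>P. be_partition A V S P"
proof -
  have "link (adj A) V z u v w" "nbrs (adj A) V x = {z, w}" using L x by (auto simp: link_sym)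
  then show ?thesis
    using short_link_step_oriented[OF L x] short_link_step_oriented[of z u v w x] x(1) uncovered_link_step[OF L] by blast
qed

lemma induction_step: "\<exists>P. be_partition A V S P"
proof (cases "V = {}")
  case True
  then show ?thesis by (intro exI[of _ "{}"]) (simp add: be_partition_def)
next
  case False
  show ?thesis
  proof (rule partial_2_tree_configuration[OF width False adj_sym adj_irrefl], goal_cases)
    case 1
    then show ?case by (rule simplicial_step)
  next
    case 2
    then show ?case by (rule twins_step)
  next
    case 3
    then show ?case by (rule long_chain_step)
  next
    case 4
    then show ?case by (rule chord_step)
  next
    case 5
    then show ?case by (rule two_links_step)
  next
    case 6
    then show ?case by (rule short_link_step)
  qed
qed

end

theorem be_partition_exists:
  assumes "be_instance A V S"
  shows "\<exists>P. be_partition A V S P"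
  using assms
proof (induction "card V" arbitrary: A V S rule: less_induct)
  case less
  interpret be_step A V S
    by (rule be_step.intro[OF less.prems be_step_axioms.intro]) (rule less.hyps)
  show ?case by (rule induction_step)
qed

section \<open>Transfer to digraphs\<close>

lemma induced_subgraph_dominates:
  assumes "induced_subgraph H D"
  shows "u \<rightarrow>\<^bsub>H\<^esub> v \<longleftrightarrow> u \<in> verts H \<and> v \<in> verts H \<and> u \<rightarrow>\<^bsub>D\<^esub> v"
proof -
  have c: "tail H = tail D" "head H = head D" "arcs H = {e \<in> arcs D. tail D e \<in> verts H \<and> head D e \<in> verts H}"
    using assms unfolding induced_subgraph_def subgraph_def compatible_def by auto
  then show ?thesis unfolding arcs_ends_def arc_to_ends_def by auto
qed

lemma series_parallel_induced_width:
  assumes D: "digraph D" "series_parallel (underlying_graph D)" and U: "U \<subseteq> verts D"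
  shows "partial_k_tree 2 U (adj (dominates D))"
proof -
  interpret digraph D by fact
  let ?E = "{{u, v} | u v. adjacent D u v}"
  have "?E \<subseteq> Pow (verts D)"
    unfolding adjacent_def using adj_in_verts by blast
  then have "finite ?E" using finite_verts finite_subset by blast
  then have E: "{s, t} \<in># snd (underlying_graph D)" if "adj (dominates D) s t" for s t
    using that unfolding underlying_graph_def adj_def adjacent_def by auto
  have "fst (underlying_graph D) = verts D" unfolding underlying_graph_def by simp
  with series_parallel_partial_2_tree[OF D(2)] show ?thesis
    using U E by (elim partial_k_tree_subgraph) auto
qed

lemma blocking_odd_cycle_of_induced_cycle:
  assumes D: "digraph D" and c: "induced_cycle (adj (dominates D)) xs" "odd (length xs)" "set xs \<subseteq> verts D"
    and ab: "a \<in> set xs" "b \<in> set xs" "adj (dominates D) a b"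
    and side: "one_sided (dominates D) (set xs) a" "one_sided (dominates D) (set xs) b"
  shows "blocking_odd_cycle (D \<restriction> set xs)"
proof -
  interpret digraph D by fact
  let ?C = "D \<restriction> set xs" and ?R = "adj (dominates D)"
  have irrefl: "\<not> ?R x x" for x unfolding adj_def using adj_not_same by blast
  have ind: "induced_subgraph ?C D" using c(3) by (rule induced_induce)
  have dom: "u \<rightarrow>\<^bsub>?C\<^esub> v \<longleftrightarrow> u \<in> set xs \<and> v \<in> set xs \<and> u \<rightarrow>\<^bsub>D\<^esub> v" for u v
    using induced_subgraph_dominates[OF ind, of u v] by simp
  have "a \<noteq> b" using ab(3) irrefl by blast
  then obtain q where q: "induced_cycle ?R (a # b # q)" "set (a # b # q) = set xs" "length (a # b # q) = length xs"
    using induced_cycle_start[where R = ?R, OF adj_sym c(1) ab(1,2) _ ab(3)] by metis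
  let ?ys = "a # b # q"
  have "{{u, v} | u v. adjacent ?C u v} = edge_set ?R (set ?ys)"
    unfolding adjacent_def edge_set_def adj_def dom q(2) by (simp add: conj_ac conj_disj_distribL)
  then have "underlying_graph ?C = cycle_mgraph ?ys"
    using induced_cycle_edges[where R = ?R, OF adj_sym irrefl q(1)] q(2)
    unfolding underlying_graph_def cycle_mgraph_def by simp
  moreover have "source ?C x \<or> sink ?C x" if "x \<in> set xs" "one_sided (dominates D) (set xs) x" for x
    using that unfolding one_sided_def source_def sink_def dom by auto
  then have "source ?C (?ys ! 0) \<or> sink ?C (?ys ! 0)" "source ?C (?ys ! 1) \<or> sink ?C (?ys ! 1)"
    using ab side by simp_all
  moreover obtain k where "length ?ys = 2 * k + 1" using c(2) q(3) by (metis oddE)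
  moreover have "k \<ge> 1" using calculation(4) by (cases k) auto
  moreover have "distinct ?ys" using q(1) by (rule induced_cycle_distinct)
  moreover have "digraph ?C" using ind by (rule digraphI_induced)
  ultimately show ?thesis unfolding blocking_odd_cycle_def by blast
qed

lemma vpath_of_successively:
  assumes "successively (dominates H) p" "set p \<subseteq> verts H" "p \<noteq> []" "distinct p"
  shows "vpath p H"
proof -
  have "set (vwalk_arcs p) \<subseteq> arcs_ends H"
    using assms(1) by (induction p rule: vwalk_arcs.induct) auto
  then show ?thesis using assms by (intro vpathI vwalkI)
qed

theorem theorem5p5:
  fixes D :: "('a, 'b) pre_digraph"
  assumes "digraph D"
    and "\<nexists>C. induced_subgraph C D \<and> blocking_odd_cycle C"
    and "series_parallel (underlying_graph D)"
  shows "BE_diperfect D"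
  unfolding BE_diperfect_def BE_property_def
proof (intro allI impI)
  fix H S assume H: "induced_subgraph H D" and S: "maximum_stable_set H S"
  interpret digraph D by fact
  let ?A = "dominates D" and ?V = "verts H"
  have VD: "?V \<subseteq> verts D" using H unfolding induced_subgraph_def subgraph_def by blast
  note dom = induced_subgraph_dominates[OF H]
  have irrefl: "\<not> ?A x x" for x using adj_not_same by blast
  have adjH: "adjacent H x y \<longleftrightarrow> adj ?A x y" if "x \<in> ?V" "y \<in> ?V" for x y
    using that unfolding adjacent_def adj_def dom by simp
  have stable: "stable_set H T \<longleftrightarrow> T \<subseteq> ?V \<and> stable (adj ?A) T" for T
  proof (cases "T \<subseteq> ?V")
    case True
    then have "(x \<noteq> y \<longrightarrow> \<not> adjacent H x y) \<longleftrightarrow> \<not> adj ?A x y" if "x \<in> T" "y \<in> T" for x y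
      using that adjH[of x y] irrefl unfolding adj_def by auto
    then show ?thesis using True unfolding stable_set_def stable_def by simp
  qed (simp add: stable_set_def)
  have "be_instance ?A ?V S"
  proof
    show "finite ?V" using VD finite_verts finite_subset by blast
    show "partial_k_tree 2 ?V (adj ?A)" using assms(1,3) VD by (rule series_parallel_induced_width)
    show "S \<subseteq> ?V" "stable (adj ?A) S" using S stable unfolding maximum_stable_set_def by blast+
    show "card T \<le> card S" if "T \<subseteq> ?V" "stable (adj ?A) T" for T
      using S stable that unfolding maximum_stable_set_def by blast
    fix xs a b
    assume c: "induced_cycle (adj ?A) xs" "odd (length xs)" "set xs \<subseteq> ?V"
      and ab: "a \<in> set xs - S" "b \<in> set xs - S" "adj ?A a b" "one_sided ?A (set xs) a" "one_sided ?A (set xs) b"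
    have xsD: "set xs \<subseteq> verts D" using c(3) VD by blast
    then have "blocking_odd_cycle (D \<restriction> set xs)"
      using blocking_odd_cycle_of_induced_cycle[OF assms(1) c(1,2)] ab by blast
    moreover have "induced_subgraph (D \<restriction> set xs) D" using xsD by (rule induced_induce)
    ultimately show False using assms(2) by blast
  qed (rule irrefl)
  then obtain P where P: "be_partition ?A ?V S P" using be_partition_exists by blast
  have sub: "set p \<subseteq> ?V" if "p \<in> P" for p using P that unfolding be_partition_def by blast
  have "vpath p H" if p: "p \<in> P" for p
  proof -
    have "be_path ?A S p" using P p unfolding be_partition_def by blast
    then have "successively ?A p" "p \<noteq> []" "distinct p" unfolding be_path_def by blast+
    moreover from this(1) have "successively (dominates H) p"
    proof (rule successively_mono)
      show "dominates H x y" if "x \<in> set p" "y \<in> set p" "?A x y" for x y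
        using that sub[OF p] dom by blast
    qed
    ultimately show ?thesis using sub[OF p] by (intro vpath_of_successively)
  qed
  then have "BE_path_partition H S P"
    using P unfolding BE_path_partition_def path_partition_def be_partition_def be_path_def by blast
  then show "\<exists>P. BE_path_partition H S P" by blast
qed

end
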